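(* Let $P=\mathbb{N}\rtimes\mathbb{N}^\times$ and let $T:P\to\mathcal{B}(\mathcal{H})$ be a unital contractive representation on a Hilbert space $\mathcal{H}$. Then $T$ has a $\ast$-regular dilation if and only if for every finite $F\subseteq P_0=\{(1,1)\}\cup\{(i,p):p\text{ prime},\ 0\le i<p\}$, $$\sum_{U\subseteq F}(-1)^{|U|}\,T(\vee U)T(\vee U)^*\ \ge\ 0.$$
   Context: $\mathbb{N}\rtimes\mathbb{N}^\times=\{(a,m):a\in\mathbb{N},m\in\mathbb{N}^\times\}$ with $\mathbb{N}=\{0,1,2,\dots\}$, $\mathbb{N}^\times=\{1,2,\dots\}$, multiplication $(a,m)(b,n)=(a+bm,mn)$ and identity $(0,1)$. It is known to be a right LCM semigroup: left cancellative, and for all $p,q\in P$ either $pP\cap qP=\emptyset$ or $pP\cap qP=rP$ for some $r\in P$. The only invertible element is $(0,1)$, so $r$ is unique. For finite $F\subset P$, $\vee F$ denotes the element $r$ with $\bigcap_{x\in F}xP=rP$ if the intersection is nonempty, and $\vee F=\infty$ otherwise; $\vee\emptyset=(0,1)$; $p\vee q=\vee\{p,q\}$. By convention $T(\infty)=0$. If $s\in pP$, $p^{-1}s$ is the unique $t$ with $pt=s$. A unital contractive representation satisfies $T((0,1))=I$, $T(pq)=T(p)T(q)$, $\|T(p)\|\le1$. $T$ has a $\ast$-regular dilation if the kernel $K(p,q)=T(p^{-1}(p\vee q))T(q^{-1}(p\vee q))^*$ if $p\vee q\ne\infty$, and $K(p,q)=0$ otherwise, is completely positive definite, i.e. $[K(p_i,p_j)]_{i,j}\ge0$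 for all $p_1,\dots,p_n\in P$. *)

theory Defs
  imports "HOL-Analysis.Operator_Norm" "HOL-Algebra.Coset" "HOL-Computational_Algebra.Primes"
begin

section \<open>Operators on complex Hilbert spaces\<close>

text \<open>
  Complex Hilbert spaces, with an inner product that is linear in its first argument.
  The real scalar multiplication, the norm and completeness come from class \<^class>\<open>banach\<close>;
  the axioms \<open>scaleR_scaleC\<close> and \<open>norm_eq_sqrt_cinner\<close> make them the ones
  belonging to the complex structure.
\<close>

class chilbert_space = banach +
  fixes scaleC :: "complex \<Rightarrow> 'a \<Rightarrow> 'a"  (infixr \<open>*\<^sub>C\<close> 75)
    and cinner :: "'a \<Rightarrow> 'a \<Rightarrow> complex"
  assumes scaleR_scaleC: "scaleR r x = complex_of_real r *\<^sub>C x"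
    and scaleC_add_right: "a *\<^sub>C (x + y) = a *\<^sub>C x + a *\<^sub>C y"
    and scaleC_add_left: "(a + b) *\<^sub>C x = a *\<^sub>C x + b *\<^sub>C x"
    and scaleC_scaleC: "a *\<^sub>C (b *\<^sub>C x) = (a * b) *\<^sub>C x"
    and scaleC_one: "1 *\<^sub>C x = x"
    and cinner_commute: "cinner x y = cnj (cinner y x)"
    and cinner_add_left: "cinner (x + y) z = cinner x z + cinner y z"
    and cinner_scaleC_left: "cinner (a *\<^sub>C x) y = a * cinner x y"
    and cinner_ge_zero: "0 \<le> Re (cinner x x)"
    and cinner_eq_zero_iff: "cinner x x = 0 \<longleftrightarrow> x = 0"
    and norm_eq_sqrt_cinner: "norm x = sqrt (Re (cinner x x))"

instantiation complex :: chilbert_space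
begin

definition scaleC_complex :: "complex \<Rightarrow> complex \<Rightarrow> complex"
  where "scaleC_complex a x = a * x"

definition cinner_complex :: "complex \<Rightarrow> complex \<Rightarrow> complex"
  where "cinner_complex x y = x * cnj y"

instance
  by standard
    (auto simp: scaleC_complex_def cinner_complex_def algebra_simps scaleR_conv_of_real
       cmod_def power2_eq_square)

end

definition bounded_clinear :: "('a::chilbert_space \<Rightarrow> 'b::chilbert_space) \<Rightarrow> bool"
  where "bounded_clinear A \<longleftrightarrow> bounded_linear A \<and> (\<forall>c x. A (c *\<^sub>C x) = c *\<^sub>C A x)"

text \<open>For a bounded operator, the adjoint exists and is unique by the Riesz representation theorem.\<close>

definition cadjoint :: "('a::chilbert_space \<Rightarrow> 'b::chilbert_space) \<Rightarrow> 'b \<Rightarrow> 'a"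
  where "cadjoint A = (THE B. \<forall>x y. cinner (A x) y = cinner x (B y))"

definition nonneg_complex :: "complex \<Rightarrow> bool"
  where "nonneg_complex z \<longleftrightarrow> Im z = 0 \<and> 0 \<le> Re z"

definition positive_op :: "('a::chilbert_space \<Rightarrow> 'a) \<Rightarrow> bool"
  where "positive_op A \<longleftrightarrow> bounded_clinear A \<and> (\<forall>h. nonneg_complex (cinner (A h) h))"

text \<open>
  Positivity of the operator matrix \<open>[A i j]\<close>, with \<open>i, j < n\<close>, acting on the
  \<open>n\<close>-fold direct sum of the Hilbert space: a vector of the direct sum is given by the values
  \<open>h i\<close> for \<open>i < n\<close>, the \<open>i\<close>-th component of its image is the inner sum, and the inner
  product of the direct sum is the sum of the componentwise ones.
\<close>

definition positive_op_matrix :: "nat \<Rightarrow> (nat \<Rightarrow> nat \<Rightarrow> 'a::chilbert_space \<Rightarrow> 'a) \<Rightarrow> bool"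
  where "positive_op_matrix n A \<longleftrightarrow>
    (\<forall>i<n. \<forall>j<n. bounded_clinear (A i j)) \<and>
    (\<forall>h. nonneg_complex (\<Sum>i<n. cinner (\<Sum>j<n. A i j (h j)) (h i)))"


section \<open>Joins and representations of right LCM monoids\<close>

text \<open>
  The value \<^term>\<open>None\<close> stands for \<open>\<infinity>\<close>.  The intersection with the carrier only matters for
  the empty set.  The description is meaningful in right LCM monoids without nontrivial
  invertible elements.
\<close>

definition rjoin :: "('p, 'm) monoid_scheme \<Rightarrow> 'p set \<Rightarrow> 'p option"
  where "rjoin P F =
    (let I = carrier P \<inter> (\<Inter>x\<in>F. x <#\<^bsub>P\<^esub> carrier P)
     in if I = {} then None else Some (THE r. r \<in> carrier P \<and> I = r <#\<^bsub>P\<^esub> carrier P))"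

text \<open>The element \<open>p\<^sup>-\<^sup>1 s\<close>, for \<open>s\<close> in the right ideal generated by \<open>p\<close>.\<close>

definition left_quotient :: "('p, 'm) monoid_scheme \<Rightarrow> 'p \<Rightarrow> 'p \<Rightarrow> 'p"
  where "left_quotient P p s = (THE t. t \<in> carrier P \<and> p \<otimes>\<^bsub>P\<^esub> t = s)"

definition unital_contractive_rep ::
    "('p, 'm) monoid_scheme \<Rightarrow> ('p \<Rightarrow> 'a::chilbert_space \<Rightarrow> 'a) \<Rightarrow> bool"
  where "unital_contractive_rep P T \<longleftrightarrow>
    (\<forall>p\<in>carrier P. bounded_clinear (T p) \<and> onorm (T p) \<le> 1) \<and>
    T \<one>\<^bsub>P\<^esub> = id \<and>
    (\<forall>p\<in>carrier P. \<forall>q\<in>carrier P. T (p \<otimes>\<^bsub>P\<^esub> q) = T p \<circ> T q)"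

definition rep_ext :: "('p \<Rightarrow> 'a::chilbert_space \<Rightarrow> 'a) \<Rightarrow> 'p option \<Rightarrow> 'a \<Rightarrow> 'a"
  where "rep_ext T s = (case s of None \<Rightarrow> (\<lambda>h. 0) | Some r \<Rightarrow> T r)"

definition star_regular_kernel ::
    "('p, 'm) monoid_scheme \<Rightarrow> ('p \<Rightarrow> 'a::chilbert_space \<Rightarrow> 'a) \<Rightarrow> 'p \<Rightarrow> 'p \<Rightarrow> 'a \<Rightarrow> 'a"
  where "star_regular_kernel P T p q =
    (case rjoin P {p, q} of
       None \<Rightarrow> (\<lambda>h. 0)
     | Some s \<Rightarrow> T (left_quotient P p s) \<circ> cadjoint (T (left_quotient P q s)))"

definition has_star_regular_dilation ::
    "('p, 'm) monoid_scheme \<Rightarrow> ('p \<Rightarrow> 'a::chilbert_space \<Rightarrow> 'a) \<Rightarrow> bool"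
  where "has_star_regular_dilation P T \<longleftrightarrow>
    (\<forall>n. \<forall>p :: nat \<Rightarrow> 'p. (\<forall>i<n. p i \<in> carrier P) \<longrightarrow>
       positive_op_matrix n (\<lambda>i j. star_regular_kernel P T (p i) (p j)))"


section \<open>The monoid \<open>\<nat> \<rtimes> \<nat>\<^sup>\<times>\<close>\<close>

definition nat_affine :: "(nat \<times> nat) monoid"
  where "nat_affine =
    \<lparr>carrier = {(a, m). 1 \<le> m},
     monoid.mult = (\<lambda>(a, m) (b, n). (a + b * m, m * n)),
     monoid.one = (0, 1)\<rparr>"

lemma monoid_nat_affine: "monoid nat_affine"
  by unfold_locales (auto simp: nat_affine_def algebra_simps)

definition nat_affine_P0 :: "(nat \<times> nat) set"
  where "nat_affine_P0 = {(1, 1)} \<union> {(i, p). prime p \<and> 0 \<le> i \<and> i < p}"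

end

theory Submission
  imports Defs "HOL-Algebra.Divisibility"
begin

text \<open>
  Think of a Nica covariant isometric dilation \<open>V\<close> of \<open>T\<close>: the range projections satisfy
  \<open>V\<^sub>p V\<^sub>p\<^sup>* V\<^sub>q V\<^sub>q\<^sup>* = V\<^sub>s V\<^sub>s\<^sup>*\<close> with \<open>s = p \<or> q\<close>, and \<open>V\<^sub>p\<^sup>*\<close> restricts to
  \<open>T(p)\<^sup>*\<close> on the original space.  The alternating sum over \<open>F\<close> is the compression of
  \<open>\<Prod>\<^bsub>x\<in>F\<^esub> (1 - V\<^sub>x V\<^sub>x\<^sup>*)\<close>, and the kernel \<open>K\<close> is the Gram matrix of the operators \<open>V\<^sub>p\<close>.
  All computations are carried out with the forms that these expressions stand for, without
  any dilation.

  If \<open>K\<close> is positive definite, testing it on the vectors \<open>(-1)\<^bsup>|U|\<^esup> T(\<or>U)\<^sup>* h\<close> at the points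
  \<open>\<or>U\<close> gives the alternating sum, since the product above is idempotent.

  Conversely, \<open>\<parallel>\<Prod>\<^bsub>x\<in>X\<^esub> (1 - V\<^sub>x V\<^sub>x\<^sup>*) (\<Sum>\<^bsub>i<n\<^esub> V\<^bsub>p i\<^esub> (h i))\<parallel>\<^sup>2\<close> is shown to be nonnegative by
  induction: the vector is split along a generator \<open>q\<close> dividing some \<open>p i\<close> until all \<open>p i\<close> are
  trivial, and then the elements of \<open>X\<close> are reduced to generators.  Both processes replace
  elements \<open>x\<close> by \<open>q\<^sup>-\<^sup>1 (q \<or> x)\<close>; they stop because this does not increase the length
  \<open>a div m + \<Omega>(m)\<close> of \<open>(a, m)\<close>.
\<close>

section \<open>Adjoints\<close>

lemma cinner_add_right: "cinner x (y + z) = cinner x y + cinner x z"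
  by (metis cinner_add_left cinner_commute complex_cnj_add)

lemma cinner_scaleC_right: "cinner x (c *\<^sub>C y) = cnj c * cinner x y"
  by (metis cinner_commute cinner_scaleC_left complex_cnj_mult)

lemma cinner_scaleR_left: "cinner (r *\<^sub>R x) y = complex_of_real r * cinner x y"
  by (simp add: scaleR_scaleC cinner_scaleC_left)

lemma cinner_scaleR_right: "cinner x (r *\<^sub>R y) = complex_of_real r * cinner x y"
  by (simp add: scaleR_scaleC cinner_scaleC_right)

lemma cinner_zero_left [simp]: "cinner 0 y = 0"
  using cinner_scaleR_left[of 0 0 y] by simp

lemma cinner_zero_right [simp]: "cinner x 0 = 0"
  using cinner_scaleR_right[of x 0 0] by simp

lemma cinner_diff_right: "cinner x (y - z) = cinner x y - cinner x z"
  using cinner_add_right[of x "y - z" z] by simp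

lemma cinner_sum_left: "cinner (\<Sum>i\<in>I. f i) y = (\<Sum>i\<in>I. cinner (f i) y)"
  by (induction I rule: infinite_finite_induct) (auto simp: cinner_add_left)

lemma cinner_sum_right: "cinner x (\<Sum>i\<in>I. f i) = (\<Sum>i\<in>I. cinner x (f i))"
  by (induction I rule: infinite_finite_induct) (auto simp: cinner_add_right)

lemma power2_norm_eq_cinner: "(norm x)\<^sup>2 = Re (cinner x x)"
  by (simp add: norm_eq_sqrt_cinner cinner_ge_zero)

lemma Re_cinner_commute: "Re (cinner x y) = Re (cinner y x)"
  by (metis cinner_commute complex_cnj complex.sel(1) complex_surj)

lemma cinner_ext: "(\<And>x. cinner x y = cinner x z) \<Longrightarrow> y = z"
  using cinner_eq_zero_iff[of "y - z"] by (simp add: cinner_diff_right)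

lemma power2_norm_add: "(norm (x + y))\<^sup>2 = (norm x)\<^sup>2 + (norm y)\<^sup>2 + 2 * Re (cinner x y)"
  for x y :: "'a::chilbert_space"
  by (simp add: power2_norm_eq_cinner cinner_add_left cinner_add_right Re_cinner_commute)

lemma Re_cinner_le_norm: "Re (cinner x y) \<le> norm x * norm y"
  for x y :: "'a::chilbert_space"
proof -
  have "(norm (x + y))\<^sup>2 \<le> (norm x + norm y)\<^sup>2"
    by (intro power_mono norm_triangle_ineq) auto
  then show ?thesis
    by (simp add: power2_norm_add power2_sum)
qed

lemma abs_Re_cinner_le_norm: "\<bar>Re (cinner x y)\<bar> \<le> norm x * norm y"
  for x y :: "'a::chilbert_space"
  using Re_cinner_le_norm[of x y] Re_cinner_le_norm[of "- x" y]
    cinner_scaleR_left[of "- 1" x y]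
  by simp

text \<open>
  The representing vector is the minimiser of \<open>\<parallel>x\<parallel>\<^sup>2 - 2 \<phi>(x)\<close>; by the parallelogram law
  every minimising sequence is Cauchy.
\<close>

lemma riesz_real:
  fixes \<phi> :: "'a::chilbert_space \<Rightarrow> real"
  assumes "bounded_linear \<phi>"
  shows "\<exists>z. \<forall>x. \<phi> x = Re (cinner x z)"
proof -
  interpret \<phi>: bounded_linear \<phi> by fact
  obtain K where K: "\<And>x. \<bar>\<phi> x\<bar> \<le> norm x * K"
    using \<phi>.bounded by auto
  define Q where "Q x = (norm x)\<^sup>2 - 2 * \<phi> x" for x
  have "- K\<^sup>2 \<le> Q x" for x
    using K[of x] zero_le_power2[of "norm x - K"]
    by (simp add: Q_def power2_diff)
  then have bdd: "bdd_below (range Q)"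
    by (intro bdd_belowI[of _ "- K\<^sup>2"]) blast
  define m where "m = Inf (range Q)"
  have m_le: "m \<le> Q x" for x
    unfolding m_def by (intro cInf_lower bdd) auto
  have "\<exists>x. Q x < m + 1 / real (Suc n)" for n
    using cInf_less_iff[OF _ bdd, of "m + 1 / real (Suc n)"] by (simp add: m_def)
  then obtain X where X: "\<And>n. Q (X n) < m + 1 / real (Suc n)"
    by metis
  have dist_le: "(norm (x - y))\<^sup>2 \<le> 2 * (Q x - m) + 2 * (Q y - m)" for x y
  proof -
    have xy: "(norm (x - y))\<^sup>2 = (norm x)\<^sup>2 + (norm y)\<^sup>2 - 2 * Re (cinner x y)"
      using power2_norm_add[of x "- y"] cinner_scaleR_right[of x "- 1" y] by simp
    have "Q ((1/2) *\<^sub>R (x + y)) = (norm (x + y))\<^sup>2 / 4 - \<phi> x - \<phi> y"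
      unfolding Q_def \<phi>.scaleR \<phi>.add norm_scaleR by (simp add: power_mult_distrib power2_eq_square field_simps)
    then have "4 * m \<le> (norm x)\<^sup>2 + (norm y)\<^sup>2 + 2 * Re (cinner x y) - 4 * \<phi> x - 4 * \<phi> y"
      using m_le[of "(1/2) *\<^sub>R (x + y)"] by (simp add: power2_norm_add field_simps)
    then show ?thesis
      using xy by (simp add: Q_def)
  qed
  have "Cauchy X"
  proof (rule CauchyI)
    fix e :: real assume "0 < e"
    then obtain N where N: "1 / real (Suc N) < e\<^sup>2 / 4"
      using nat_approx_posE[of "e\<^sup>2 / 4"] by auto
    have "norm (X i - X j) < e" if "N \<le> i" "N \<le> j" for i j
    proof -
      have close: "Q (X k) - m < e\<^sup>2 / 4" if "N \<le> k" for k
        using X[of k] N that frac_le[of 1 1 "real (Suc N)" "real (Suc k)"] by simp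
      have "(norm (X i - X j))\<^sup>2 < e\<^sup>2"
        using dist_le[of "X i" "X j"] close[of i] close[of j] that by simp
      then show ?thesis
        using \<open>0 < e\<close> by (simp add: power2_less_imp_less)
    qed
    then show "\<exists>M. \<forall>i\<ge>M. \<forall>j\<ge>M. norm (X i - X j) < e"
      by blast
  qed
  then obtain z where z: "X \<longlonglongrightarrow> z"
    using Cauchy_convergent convergent_def by blast
  have "(\<lambda>n. Q (X n)) \<longlonglongrightarrow> Q z"
    unfolding Q_def by (intro tendsto_intros z \<phi>.tendsto)
  moreover have "(\<lambda>n. m + 1 / real (Suc n)) \<longlonglongrightarrow> m + 0"
    by (intro tendsto_intros LIMSEQ_inverse_real_of_nat[unfolded inverse_eq_divide])
  ultimately have "Q z \<le> m"
    using X by (intro LIMSEQ_le[of _ "Q z" _ m]) (auto intro: less_imp_le)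
  have "\<phi> x = Re (cinner x z)" for x
  proof -
    define c where "c = Re (cinner x z) - \<phi> x"
    \<comment> \<open>A step along \<open>x\<close> that is nearly optimal for decreasing
      \<open>Q\<close>; the added 1 keeps the denominator positive at \<open>x = 0\<close>, and
      minimality of \<open>z\<close> still forces \<open>t = 0\<close>.\<close>
    define t where "t = c / ((norm x)\<^sup>2 + 1)"
    have pos: "0 < (norm x)\<^sup>2 + 1"
      by (simp add: add_nonneg_pos)
    have "Q z \<le> Q (z + (- t) *\<^sub>R x)"
      using \<open>Q z \<le> m\<close> m_le order_trans by blast
    also have "\<dots> = Q z + t\<^sup>2 * (norm x)\<^sup>2 - 2 * t * c"
      unfolding Q_def power2_norm_add \<phi>.add \<phi>.scaleR cinner_scaleR_right c_def
      by (simp add: power_mult_distrib algebra_simps Re_cinner_commute[of z x])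
    finally have "2 * t * c \<le> t\<^sup>2 * (norm x)\<^sup>2" by simp
    moreover have "c = t * ((norm x)\<^sup>2 + 1)"
      using pos by (simp add: t_def)
    ultimately have "2 * t\<^sup>2 * ((norm x)\<^sup>2 + 1) \<le> t\<^sup>2 * (norm x)\<^sup>2"
      by (simp add: power2_eq_square algebra_simps)
    then have "t\<^sup>2 * ((norm x)\<^sup>2 + 2) \<le> 0"
      by (simp add: algebra_simps)
    moreover have "0 < (norm x)\<^sup>2 + 2"
      using pos by simp
    ultimately have "t = 0"
      by (metis mult_pos_pos not_less zero_less_power2)
    then show ?thesis
      using \<open>c = t * _\<close> by (simp add: c_def)
  qed
  then show ?thesis by blast
qed

section \<open>Bounded complex linear operators and their adjoints\<close>

lemma bounded_clinearD:
  assumes "bounded_clinear A"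
  shows "bounded_linear A" "A (x + y) = A x + A y" "A (c *\<^sub>C x) = c *\<^sub>C A x" "A 0 = 0"
    "A (\<Sum>i\<in>I. f i) = (\<Sum>i\<in>I. A (f i))"
  using assms bounded_linear.linear[of A] unfolding bounded_clinear_def
  by (auto simp: linear_add linear_0 linear_sum)

text \<open>The real Riesz theorem represents the real part of the functional; by complex linearity
  of \<open>A\<close>, evaluation at \<open>\<i> *\<^sub>C x\<close> shows that the same vector
  represents the imaginary part.\<close>

lemma adjoint_exists:
  fixes A :: "'a::chilbert_space \<Rightarrow> 'b::chilbert_space"
  assumes "bounded_clinear A"
  shows "\<exists>B. \<forall>x y. cinner (A x) y = cinner x (B y)"
proof -
  interpret A: bounded_linear A by (rule bounded_clinearD(1)[OF assms])
  have "\<exists>z. \<forall>x. cinner (A x) y = cinner x z" for y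
  proof -
    have "bounded_linear (\<lambda>x. Re (cinner (A x) y))"
    proof (rule bounded_linear_intro)
      show "norm (Re (cinner (A x) y)) \<le> norm x * (onorm A * norm y)" for x
        using abs_Re_cinner_le_norm[of "A x" y]
          mult_right_mono[OF onorm[OF bounded_clinearD(1)[OF assms], of x], of "norm y"]
        by (simp add: mult.commute mult.left_commute)
    qed (simp_all add: A.add A.scaleR cinner_add_left cinner_scaleR_left)
    then obtain z where z: "\<And>x. Re (cinner (A x) y) = Re (cinner x z)"
      using riesz_real by blast
    have "Im (cinner (A x) y) = Im (cinner x z)" for x
      using z[of "\<i> *\<^sub>C x"] by (simp add: bounded_clinearD(3)[OF assms] cinner_scaleC_left)
    then show ?thesis
      using z complex_eqI by blast
  qed
  then show ?thesis by metis
qed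

lemma cadjoint_eqI:
  assumes "\<And>x y. cinner (A x) y = cinner x (B y)"
  shows "cadjoint A = B"
  unfolding cadjoint_def
proof (rule the_equality)
  fix C assume C: "\<forall>x y. cinner (A x) y = cinner x (C y)"
  show "C = B"
  proof
    show "C y = B y" for y
      by (rule cinner_ext) (use C assms in metis)
  qed
qed (use assms in blast)

lemma cinner_cadjoint:
  assumes "bounded_clinear A"
  shows "cinner (A x) y = cinner x (cadjoint A y)"
  using adjoint_exists[OF assms] cadjoint_eqI[of A] by metis

lemma cadjoint_compose:
  assumes "bounded_clinear A" "bounded_clinear B"
  shows "cadjoint (A \<circ> B) = cadjoint B \<circ> cadjoint A"
  by (rule cadjoint_eqI) (simp add: assms cinner_cadjoint)

lemma bounded_clinear_zero: "bounded_clinear (\<lambda>h. 0)"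
  using scaleC_add_right[of _ 0 0] by (auto simp: bounded_clinear_def)

lemma cadjoint_zero: "cadjoint (\<lambda>h. 0) = (\<lambda>h. 0)"
  by (rule cadjoint_eqI) simp

lemma bounded_clinear_compose:
  "bounded_clinear A \<Longrightarrow> bounded_clinear B \<Longrightarrow> bounded_clinear (\<lambda>h. A (B h))"
  by (auto simp: bounded_clinear_def intro: bounded_linear_compose)

lemma bounded_clinear_scaleR:
  "bounded_clinear A \<Longrightarrow> bounded_clinear (\<lambda>h. r *\<^sub>R A h)"
  unfolding bounded_clinear_def
  by (intro conjI bounded_linear_const_scaleR) (auto simp: scaleR_scaleC scaleC_scaleC mult.commute)

lemma bounded_clinear_add:
  "bounded_clinear A \<Longrightarrow> bounded_clinear B \<Longrightarrow> bounded_clinear (\<lambda>h. A h + B h)"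
  by (auto simp: bounded_clinear_def scaleC_add_right intro: bounded_linear_add)

lemma bounded_clinear_sum:
  "(\<And>i. i \<in> I \<Longrightarrow> bounded_clinear (A i)) \<Longrightarrow> bounded_clinear (\<lambda>h. \<Sum>i\<in>I. A i h)"
  by (induction I rule: infinite_finite_induct)
    (auto simp: bounded_clinear_zero bounded_clinear_add)

lemma bounded_clinear_cadjoint:
  fixes A :: "'a::chilbert_space \<Rightarrow> 'b::chilbert_space"
  assumes "bounded_clinear A"
  shows "bounded_clinear (cadjoint A)"
proof -
  note adj = cinner_cadjoint[OF assms]
  have add: "cadjoint A (x + y) = cadjoint A x + cadjoint A y" for x y
    by (rule cinner_ext) (simp add: cinner_add_right flip: adj)
  have scale: "cadjoint A (c *\<^sub>C x) = c *\<^sub>C cadjoint A x" for c x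
    by (rule cinner_ext) (simp add: cinner_scaleC_right flip: adj)
  have "norm (cadjoint A y) \<le> norm y * onorm A" for y
  proof -
    let ?z = "cadjoint A y"
    have "(norm ?z)\<^sup>2 = Re (cinner (A ?z) y)"
      by (simp add: adj power2_norm_eq_cinner)
    also have "\<dots> \<le> norm (A ?z) * norm y"
      by (rule Re_cinner_le_norm)
    also have "\<dots> \<le> onorm A * norm ?z * norm y"
      by (intro mult_right_mono onorm bounded_clinearD(1)[OF assms]) auto
    finally have "norm ?z * norm ?z \<le> norm ?z * (norm y * onorm A)"
      by (simp add: power2_eq_square mult_ac)
    moreover have "0 \<le> norm y * onorm A"
      by (simp add: onorm_pos_le bounded_clinearD(1)[OF assms])
    ultimately show ?thesis
      by (cases "?z = 0") auto
  qed
  then have "bounded_linear (cadjoint A)"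
    by (intro bounded_linear_intro[of _ "onorm A"]) (auto simp: add scale scaleR_scaleC)
  then show ?thesis
    by (simp add: bounded_clinear_def scale)
qed

lemma nonneg_complex_add: "nonneg_complex x \<Longrightarrow> nonneg_complex y \<Longrightarrow> nonneg_complex (x + y)"
  by (simp add: nonneg_complex_def)


section \<open>Right LCM monoids without units\<close>

text \<open>\<open>p divides t\<close> means that \<open>t\<close> lies in the right ideal generated
  by \<open>p\<close>, so \<open>right_lcm\<close> says that two such ideals which meet intersect in
  a principal one.\<close>

locale right_lcm_monoid = monoid P for P (structure) +
  assumes left_cancel:
      "\<lbrakk>p \<otimes> s = p \<otimes> t; p \<in> carrier P; s \<in> carrier P; t \<in> carrier P\<rbrakk> \<Longrightarrow> s = t"
    and unit_trivial: "\<lbrakk>p \<otimes> q = \<one>; p \<in> carrier P; q \<in> carrier P\<rbrakk> \<Longrightarrow> p = \<one>"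
    and right_lcm:
      "\<lbrakk>p \<in> carrier P; q \<in> carrier P; t \<in> carrier P; p divides t; q divides t\<rbrakk> \<Longrightarrow>
        \<exists>r\<in>carrier P. \<forall>u\<in>carrier P. (p divides u \<and> q divides u) \<longleftrightarrow> r divides u"
begin

text \<open>The intersection of the right ideals generated by the elements of \<open>F\<close>, and
  the whole carrier for empty \<open>F\<close>; \<open>rjoin P F\<close> picks its
  generator.\<close>

definition upper_bounds :: "'a set \<Rightarrow> 'a set"
  where "upper_bounds F = {t \<in> carrier P. \<forall>x\<in>F. x divides t}"

lemma upper_bounds_carrier: "upper_bounds F \<subseteq> carrier P"
  by (auto simp: upper_bounds_def)

lemma upper_bounds_Un: "upper_bounds (F \<union> G) = upper_bounds F \<inter> upper_bounds G"
  by (auto simp: upper_bounds_def)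

lemma divides_antisym:
  assumes "p divides q" "q divides p" "p \<in> carrier P" "q \<in> carrier P"
  shows "p = q"
proof -
  obtain s t where st: "s \<in> carrier P" "q = p \<otimes> s" "t \<in> carrier P" "p = q \<otimes> t"
    using assms by (auto simp: factor_def)
  have "p \<otimes> (s \<otimes> t) = p \<otimes> \<one>"
    using st assms(3) by (simp flip: m_assoc)
  then have "s \<otimes> t = \<one>"
    using left_cancel st assms(3) by blast
  then have "s = \<one>"
    using unit_trivial st by blast
  then show ?thesis
    using st assms(3) by simp
qed

lemma one_divides [simp]: "p \<in> carrier P \<Longrightarrow> \<one> divides p"
  by (auto simp: factor_def)

lemma divides_mult_left:
  assumes "q \<in> carrier P" "s \<in> carrier P" "t \<in> carrier P"
  shows "q \<otimes> s divides q \<otimes> t \<longleftrightarrow> s divides t"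
proof
  assume "q \<otimes> s divides q \<otimes> t"
  then obtain c where c: "c \<in> carrier P" "q \<otimes> t = q \<otimes> s \<otimes> c"
    by (auto simp: factor_def)
  then have "t = s \<otimes> c"
    using left_cancel[of q t "s \<otimes> c"] assms by (simp add: m_assoc)
  with c show "s divides t"
    by (auto simp: factor_def)
next
  assume "s divides t"
  then obtain c where "c \<in> carrier P" "t = s \<otimes> c"
    by (auto simp: factor_def)
  then show "q \<otimes> s divides q \<otimes> t"
    using assms by (auto simp: factor_def m_assoc intro!: bexI[of _ c])
qed

lemma left_quotient_mult:
  "\<lbrakk>p \<in> carrier P; t \<in> carrier P\<rbrakk> \<Longrightarrow> left_quotient P p (p \<otimes> t) = t"
  unfolding left_quotient_def by (rule the_equality) (auto dest: left_cancel)

lemma left_quotient: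
  assumes "p divides s" "p \<in> carrier P"
  shows "left_quotient P p s \<in> carrier P" "p \<otimes> left_quotient P p s = s"
  using assms left_quotient_mult by (auto simp: factor_def)

lemma left_quotient_one: "p \<in> carrier P \<Longrightarrow> left_quotient P \<one> p = p"
  using left_quotient_mult[of \<one> p] by simp

lemma left_quotient_divides_iff:
  assumes "p divides s" "p \<in> carrier P" "t \<in> carrier P" "s \<in> carrier P"
  shows "left_quotient P p s divides t \<longleftrightarrow> s divides p \<otimes> t"
  using divides_mult_left[of p "left_quotient P p s" t] left_quotient[OF assms(1,2)] assms by simp

lemma left_quotient_trans:
  assumes "p divides s" "s divides t" "p \<in> carrier P" "s \<in> carrier P" "t \<in> carrier P"
  shows "left_quotient P p t = left_quotient P p s \<otimes> left_quotient P s t"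
proof -
  have "p \<otimes> (left_quotient P p s \<otimes> left_quotient P s t) = t"
    using left_quotient[OF assms(1,3)] left_quotient[OF assms(2,4)] assms(3)
    by (simp flip: m_assoc)
  then show ?thesis
    using left_quotient_mult[of p "left_quotient P p s \<otimes> left_quotient P s t"]
      left_quotient[OF assms(1,3)] left_quotient[OF assms(2,4)] assms(3) by simp
qed

section \<open>Joins as generators of intersections of right ideals\<close>

lemma rjoin_ideal: "carrier P \<inter> (\<Inter>x\<in>F. x <# carrier P) = upper_bounds F"
  by (auto simp: upper_bounds_def factor_def l_coset_def)

lemma ideal_eq: "r \<in> carrier P \<Longrightarrow> r <# carrier P = upper_bounds {r}"
  by (auto simp: upper_bounds_def factor_def l_coset_def)

lemma rjoin_alt:
  "rjoin P F = (if upper_bounds F = {} then None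
     else Some (THE r. r \<in> carrier P \<and> upper_bounds F = upper_bounds {r}))"
proof -
  have "(r \<in> carrier P \<and> upper_bounds F = r <# carrier P) \<longleftrightarrow>
      (r \<in> carrier P \<and> upper_bounds F = upper_bounds {r})" for r
    using ideal_eq by auto
  then show ?thesis
    unfolding rjoin_def rjoin_ideal by (simp add: Let_def)
qed

lemma rjoin_cong: "upper_bounds F = upper_bounds G \<Longrightarrow> rjoin P F = rjoin P G"
  by (simp add: rjoin_alt)

lemma upper_bounds_singleton_inject:
  "\<lbrakk>upper_bounds {r} = upper_bounds {s}; r \<in> carrier P; s \<in> carrier P\<rbrakk> \<Longrightarrow> r = s"
  by (rule divides_antisym) (auto simp: upper_bounds_def set_eq_iff)

text \<open>The ideal of the smaller set already has a generator, so each induction step intersects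
  just two principal ideals, where \<open>right_lcm\<close> applies.\<close>

lemma upper_bounds_principal:
  assumes "finite F" "F \<subseteq> carrier P" "upper_bounds F \<noteq> {}"
  shows "\<exists>r\<in>carrier P. upper_bounds F = upper_bounds {r}"
  using assms
proof (induction F)
  case empty
  show ?case
    by (rule bexI[of _ \<one>]) (auto simp: upper_bounds_def)
next
  case (insert x F)
  then obtain r where r: "r \<in> carrier P" "upper_bounds F = upper_bounds {r}"
    by (auto simp: upper_bounds_def)
  have eq: "upper_bounds (insert x F) = upper_bounds {x, r}"
    using r(2) by (auto simp: upper_bounds_def set_eq_iff)
  have "upper_bounds {x, r} \<noteq> {}"
    using insert.prems eq by simp
  then obtain t where "t \<in> carrier P" "x divides t" "r divides t"
    by (auto simp: upper_bounds_def)
  then obtain s where "s \<in> carrier P"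
    "\<forall>u\<in>carrier P. (x divides u \<and> r divides u) \<longleftrightarrow> s divides u"
    using right_lcm[of x r t] r insert.prems by auto
  then show ?case
    unfolding eq by (intro bexI[of _ s]) (auto simp: upper_bounds_def)
qed

lemma rjoin_eq_None_iff: "rjoin P F = None \<longleftrightarrow> upper_bounds F = {}"
  by (simp add: rjoin_alt)

lemma rjoin_eqI:
  assumes "r \<in> carrier P" "upper_bounds F = upper_bounds {r}"
  shows "rjoin P F = Some r"
proof -
  have "r \<in> upper_bounds {r}"
    using assms(1) by (auto simp: upper_bounds_def)
  moreover have "(THE r. r \<in> carrier P \<and> upper_bounds F = upper_bounds {r}) = r"
    using assms upper_bounds_singleton_inject by (intro the_equality) auto
  ultimately show ?thesis
    using assms(2) by (auto simp: rjoin_alt)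
qed

lemma rjoin_SomeD:
  assumes "rjoin P F = Some r" "finite F" "F \<subseteq> carrier P"
  shows "r \<in> carrier P" "upper_bounds F = upper_bounds {r}" "x \<in> F \<Longrightarrow> x divides r"
proof -
  obtain s where s: "s \<in> carrier P" "upper_bounds F = upper_bounds {s}"
    using upper_bounds_principal[of F] rjoin_eq_None_iff[of F] assms by auto
  then have "r = s"
    using rjoin_eqI[of s F] assms(1) by simp
  with s show "r \<in> carrier P" and ub: "upper_bounds F = upper_bounds {r}" by auto
  then have "r \<in> upper_bounds F"
    by (auto simp: upper_bounds_def)
  then show "x \<in> F \<Longrightarrow> x divides r"
    by (auto simp: upper_bounds_def)
qed

lemma rjoin_insert_redundant:
  assumes "x divides y" "y \<in> S" "x \<in> carrier P"
  shows "rjoin P (insert x S) = rjoin P S"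
  using assms divides_trans by (intro rjoin_cong) (auto simp: upper_bounds_def)

section \<open>Residuals and joins with a common left factor\<close>

definition compat :: "'a \<Rightarrow> 'a \<Rightarrow> bool"
  where "compat q x \<longleftrightarrow> upper_bounds {q, x} \<noteq> {}"

text \<open>Meaningful only under \<open>compat q x\<close>. It arises when an adjoint moves past a
  projection: \<open>V\<^sub>q\<^sup>* V\<^sub>x V\<^sub>x\<^sup>* = V\<^sub>r V\<^sub>r\<^sup>*
  V\<^sub>q\<^sup>*\<close> for \<open>r = resid q x\<close>.\<close>

definition resid :: "'a \<Rightarrow> 'a \<Rightarrow> 'a"
  where "resid q x = left_quotient P q (the (rjoin P {q, x}))"

text \<open>Since \<open>q\<close> divides \<open>q \<otimes> t\<close>, the join divides it exactly
  if \<open>x\<close> does; cancelling \<open>q\<close> gives the universal property.\<close>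

lemma resid:
  assumes "compat q x" "q \<in> carrier P" "x \<in> carrier P"
  shows "resid q x \<in> carrier P"
    and "t \<in> carrier P \<Longrightarrow> resid q x divides t \<longleftrightarrow> x divides q \<otimes> t"
    and "rjoin P {q, x} = Some (q \<otimes> resid q x)"
    and "x divides q \<otimes> resid q x"
proof -
  obtain s where s: "rjoin P {q, x} = Some s"
    using assms(1) by (auto simp: compat_def simp flip: rjoin_eq_None_iff)
  note sD = rjoin_SomeD[OF s]
  have "q divides s" "s \<in> carrier P" and xs: "x divides s"
    using sD assms by auto
  then show "resid q x \<in> carrier P" and eq: "rjoin P {q, x} = Some (q \<otimes> resid q x)"
    using left_quotient s assms by (auto simp: resid_def)
  then show "x divides q \<otimes> resid q x"
    using xs s by simp
  show "resid q x divides t \<longleftrightarrow> x divides q \<otimes> t" if t: "t \<in> carrier P"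
  proof -
    have "resid q x divides t \<longleftrightarrow> s divides q \<otimes> t"
      using left_quotient_divides_iff[OF \<open>q divides s\<close>] s t assms \<open>s \<in> carrier P\<close>
      by (simp add: resid_def)
    also have "\<dots> \<longleftrightarrow> q \<otimes> t \<in> upper_bounds {q, x}"
      using sD(2) assms t by (simp add: upper_bounds_def)
    also have "\<dots> \<longleftrightarrow> x divides q \<otimes> t"
      using assms t by (auto simp: upper_bounds_def)
    finally show ?thesis .
  qed
qed

lemma resid_eqI:
  assumes "q \<in> carrier P" "x \<in> carrier P" "r \<in> carrier P"
    and "\<And>t. t \<in> carrier P \<Longrightarrow> x divides q \<otimes> t \<longleftrightarrow> r divides t"
  shows "compat q x" "resid q x = r"
proof -
  have "q \<otimes> r \<in> upper_bounds {q, x}"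
    using assms by (auto simp: upper_bounds_def)
  then show c: "compat q x"
    by (auto simp: compat_def)
  note rs = resid[OF c assms(1,2)]
  show "resid q x = r"
    by (rule divides_antisym) (use rs assms in auto)
qed

lemma resid_mult:
  assumes "q \<in> carrier P" "r \<in> carrier P"
  shows "compat q (q \<otimes> r)" "resid q (q \<otimes> r) = r"
  using resid_eqI[of q "q \<otimes> r" r] assms by (auto simp: divides_mult_left)

lemma upper_bounds_insert_mult:
  assumes "q \<in> carrier P" "S \<subseteq> carrier P" "\<forall>x\<in>S. compat q x"
  shows "upper_bounds (insert q S) = (\<lambda>t. q \<otimes> t) ` upper_bounds (resid q ` S)"
proof -
  have "x divides q \<otimes> t \<longleftrightarrow> resid q x divides t" if "x \<in> S" "t \<in> carrier P" for x t
    using resid(2)[of q x t] assms that by auto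
  then have "q \<otimes> t \<in> upper_bounds (insert q S) \<longleftrightarrow> t \<in> upper_bounds (resid q ` S)"
    if "t \<in> carrier P" for t
    using assms(1) that by (auto simp: upper_bounds_def)
  moreover have "\<exists>t\<in>carrier P. s = q \<otimes> t" if "s \<in> upper_bounds (insert q S)" for s
    using that by (auto simp: upper_bounds_def factor_def)
  ultimately show ?thesis
    using upper_bounds_carrier by blast
qed

text \<open>Every common multiple of \<open>insert q S\<close> starts with \<open>q\<close>. After
  cancelling \<open>q\<close>, each \<open>x\<close> demands divisibility by its residual; a single
  incompatible \<open>x\<close> leaves no common multiple.\<close>

lemma rjoin_insert_shift:
  assumes "q \<in> carrier P" "S \<subseteq> carrier P" "finite S"
  shows "rjoin P (insert q S) = (if \<forall>x\<in>S. compat q x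
    then map_option (\<lambda>t. q \<otimes> t) (rjoin P (resid q ` S)) else None)"
proof (cases "\<forall>x\<in>S. compat q x")
  case False
  then show ?thesis
    by (auto simp: rjoin_eq_None_iff compat_def upper_bounds_def)
next
  case True
  have carr: "resid q ` S \<subseteq> carrier P"
    using True resid(1) assms by auto
  note ub = upper_bounds_insert_mult[OF assms(1,2) True]
  show ?thesis
  proof (cases "rjoin P (resid q ` S)")
    case None
    then have "upper_bounds (resid q ` S) = {}"
      by (simp add: rjoin_eq_None_iff)
    then have "rjoin P (insert q S) = None"
      using ub by (simp add: rjoin_eq_None_iff)
    then show ?thesis
      using None by simp
  next
    case (Some r)
    note rD = rjoin_SomeD[OF Some _ carr]
    have "r \<in> carrier P" using rD assms by blast
    have "upper_bounds (insert q S) = (\<lambda>t. q \<otimes> t) ` upper_bounds {r}"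
      using ub rD(2) assms(3) by simp
    also have "\<dots> = upper_bounds {q \<otimes> r}"
      using assms \<open>r \<in> carrier P\<close> divides_mult_left
      by (auto simp: upper_bounds_def image_iff factor_def m_assoc)
    finally have "rjoin P (insert q S) = Some (q \<otimes> r)"
      using assms \<open>r \<in> carrier P\<close> by (intro rjoin_eqI) auto
    then show ?thesis
      using True Some by simp
  qed
qed


section \<open>Alternating sums over joins\<close>

text \<open>Formal expansion of the product of \<open>V\<^sub>s V\<^sub>s\<^sup>*\<close> over
  \<open>s \<in> S\<close> and \<open>1 - V\<^sub>x V\<^sub>x\<^sup>*\<close> over
  \<open>x \<in> X\<close>; \<open>g\<close> evaluates the range projection of each join.\<close>

definition alt_join_sum :: "'a set \<Rightarrow> 'a set \<Rightarrow> ('a option \<Rightarrow> 'c::real_vector) \<Rightarrow> 'c"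
  where "alt_join_sum X S g = (\<Sum>U\<in>Pow X. (-1) ^ card U *\<^sub>R g (rjoin P (S \<union> U)))"

lemma alt_join_sum_insert_new:
  assumes "finite X" "x \<notin> X"
  shows "alt_join_sum (insert x X) S g = alt_join_sum X S g - alt_join_sum X (insert x S) g"
proof -
  have "(\<Sum>U\<in>insert x ` Pow X. (-1) ^ card U *\<^sub>R g (rjoin P (S \<union> U))) =
      (\<Sum>U\<in>Pow X. (-1) ^ card (insert x U) *\<^sub>R g (rjoin P (S \<union> insert x U)))"
    using assms by (subst sum.reindex) (auto simp: inj_on_def)
  also have "\<dots> = (\<Sum>U\<in>Pow X. - ((-1) ^ card U *\<^sub>R g (rjoin P (insert x S \<union> U))))"
  proof (rule sum.cong)
    fix U assume "U \<in> Pow X"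
    then have "finite U" "x \<notin> U"
      using assms finite_subset by auto
    then show "(-1) ^ card (insert x U) *\<^sub>R g (rjoin P (S \<union> insert x U)) =
        - ((-1) ^ card U *\<^sub>R g (rjoin P (insert x S \<union> U)))"
      by simp
  qed simp
  finally show ?thesis
    using assms unfolding alt_join_sum_def Pow_insert
    by (subst sum.union_disjoint) (auto simp: sum_negf)
qed

text \<open>For \<open>x \<in> X\<close> the subtracted sum has \<open>x\<close> in both sets and
  vanishes.\<close>

lemma alt_join_sum_insert:
  assumes "finite X"
  shows "alt_join_sum (insert x X) S g = alt_join_sum X S g - alt_join_sum X (insert x S) g"
proof (cases "x \<in> X")
  case True
  then obtain Y where "X = insert x Y" "x \<notin> Y"
    by (meson Set.set_insert)
  then show ?thesis
    using assms alt_join_sum_insert_new[of Y x "insert x S" g] by simp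
qed (use assms alt_join_sum_insert_new in blast)

lemma alt_join_sum_cong:
  assumes "\<And>U. U \<subseteq> X \<Longrightarrow> g (rjoin P (S \<union> U)) = h (rjoin P (S' \<union> U))"
  shows "alt_join_sum X S g = alt_join_sum X S' h"
  unfolding alt_join_sum_def using assms by (intro sum.cong) auto

lemma alt_join_sum_zero: "alt_join_sum X S (\<lambda>r. 0) = 0"
  by (simp add: alt_join_sum_def)

lemma alt_join_sum_insert_redundant:
  assumes "x divides y" "y \<in> S" "x \<in> carrier P"
  shows "alt_join_sum X (insert x S) g = alt_join_sum X S g"
  using rjoin_insert_redundant[OF assms(1) _ assms(3), of "S \<union> U" for U] assms(2)
  by (intro alt_join_sum_cong) simp

text \<open>The range of \<open>V\<^sub>y\<close> lies in that of \<open>V\<^sub>x\<close>, so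
  \<open>1 - V\<^sub>x V\<^sub>x\<^sup>*\<close> annihilates it.\<close>

lemma alt_join_sum_eq_zero:
  assumes "finite X" "x divides y" "x \<in> X" "y \<in> S" "x \<in> carrier P"
  shows "alt_join_sum X S g = 0"
  using alt_join_sum_insert[OF assms(1), of x S g] alt_join_sum_insert_redundant[OF assms(2,4,5), of X g] assms(3)
  by (simp add: insert_absorb)

lemma alt_join_sum_incompatible:
  assumes "g None = 0" "x \<in> S" "y \<in> S" "\<not> compat x y"
  shows "alt_join_sum X S g = 0"
proof -
  have "rjoin P (S \<union> U) = None" for U
    using assms by (auto simp: rjoin_eq_None_iff compat_def upper_bounds_def)
  then show ?thesis
    by (simp add: alt_join_sum_def assms(1))
qed

text \<open>Moving the adjoint of \<open>V\<^sub>q\<close> past the factors replaces each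
  \<open>x\<close> by its residual. For incompatible \<open>x\<close> and \<open>q\<close> the
  product of the range projections is 0, so the factor of \<open>x\<close> becomes 1 and
  \<open>x\<close> drops out of \<open>X\<close>.\<close>

lemma alt_join_sum_shift:
  assumes "finite X" "X \<subseteq> carrier P" "finite S" "S \<subseteq> carrier P" "q \<in> carrier P"
    and "\<forall>x\<in>S. compat q x" "g None = 0"
  shows "alt_join_sum X (insert q S) g =
    alt_join_sum (resid q ` {x \<in> X. compat q x}) (resid q ` S) (g \<circ> map_option (\<lambda>t. q \<otimes> t))"
  using assms(1-4,6)
\<comment> \<open>\<open>S\<close> varies because the recursion moves elements of \<open>X\<close>
  into it.\<close>
proof (induction X arbitrary: S)
  case empty
  then show ?case
    using rjoin_insert_shift[of q S] assms(5) by (simp add: alt_join_sum_def)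
next
  case (insert x X)
  have rec: "alt_join_sum (insert x X) (insert q S) g =
      alt_join_sum X (insert q S) g - alt_join_sum X (insert q (insert x S)) g"
    using insert.hyps by (simp add: alt_join_sum_insert insert_commute)
  show ?case
  proof (cases "compat q x")
    case True
    then have "{y \<in> insert x X. compat q y} = insert x {y \<in> X. compat q y}"
      by auto
    then show ?thesis
      using rec insert True by (simp add: alt_join_sum_insert)
  next
    case False
    then have "{y \<in> insert x X. compat q y} = {y \<in> X. compat q y}"
      by auto
    moreover have "alt_join_sum X (insert q (insert x S)) g = 0"
      using False assms(7) by (intro alt_join_sum_incompatible[of g q _ x]) auto
    ultimately show ?thesis
      using rec insert by simp
  qed
qed

text \<open>
  In terms of the projections \<open>1 - V\<^sub>x V\<^sub>x\<^sup>*\<close>, this is the fact that their product is idempotent.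
\<close>

lemma alt_join_sum_idem:
  assumes "finite X" "X \<subseteq> carrier P"
  shows "(\<Sum>W\<in>Pow X. (-1) ^ card W *\<^sub>R alt_join_sum X W g) = alt_join_sum X {} g"
proof -
  have "(\<Sum>W\<in>Pow X. (-1) ^ card W *\<^sub>R alt_join_sum X W g) =
      (\<Sum>W\<in>{{}}. (-1) ^ card W *\<^sub>R alt_join_sum X W g)"
  proof (rule sum.mono_neutral_right)
    show "\<forall>W\<in>Pow X - {{}}. (-1) ^ card W *\<^sub>R alt_join_sum X W g = 0"
    proof
      fix W assume "W \<in> Pow X - {{}}"
      then obtain x where "x \<in> W" "x \<in> X" by auto
      then show "(-1) ^ card W *\<^sub>R alt_join_sum X W g = 0"
        using alt_join_sum_eq_zero[of X x x W g] assms by auto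
    qed
  qed (use assms in auto)
  then show ?thesis by simp
qed

end


section \<open>Gram forms of a representation\<close>

definition rep_adj :: "('p \<Rightarrow> 'a::chilbert_space \<Rightarrow> 'a) \<Rightarrow> 'p option \<Rightarrow> 'a \<Rightarrow> 'a"
  where "rep_adj T r = cadjoint (rep_ext T r)"

lemma rep_adj_None [simp]: "rep_adj T None h = 0"
  by (simp add: rep_adj_def rep_ext_def cadjoint_zero)

lemma rep_adj_Some: "rep_adj T (Some s) = cadjoint (T s)"
  by (simp add: rep_adj_def rep_ext_def)

definition range_form :: "('p \<Rightarrow> 'a::chilbert_space \<Rightarrow> 'a) \<Rightarrow> 'a \<Rightarrow> 'p option \<Rightarrow> complex"
  where "range_form T h r = cinner (rep_adj T r h) (rep_adj T r h)"

context right_lcm_monoid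
begin

lemma alt_join_sum_cong_carrier:
  assumes "finite X" "X \<subseteq> carrier P" "finite S" "S \<subseteq> carrier P"
    and "g None = h None"
    and "\<And>r. \<lbrakk>r \<in> carrier P; \<forall>x\<in>S. x divides r\<rbrakk> \<Longrightarrow> g (Some r) = h (Some r)"
  shows "alt_join_sum X S g = alt_join_sum X S h"
proof (rule alt_join_sum_cong)
  fix U assume "U \<subseteq> X"
  then have fin: "finite (S \<union> U)" "S \<union> U \<subseteq> carrier P"
    using assms finite_subset by auto
  show "g (rjoin P (S \<union> U)) = h (rjoin P (S \<union> U))"
  proof (cases "rjoin P (S \<union> U)")
    case (Some r)
    then show ?thesis
      using rjoin_SomeD(1,3)[OF Some fin] assms(6) by auto
  qed (simp add: assms)
qed

lemma alt_join_sum_insert_one: "alt_join_sum X (insert \<one> S) g = alt_join_sum X S g"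
proof (rule alt_join_sum_cong)
  show "g (rjoin P (insert \<one> S \<union> U)) = g (rjoin P (S \<union> U))" for U
    by (intro arg_cong[of _ _ g] rjoin_cong) (auto simp: upper_bounds_def)
qed

lemma alt_join_sum_one_mem:
  assumes "finite X" "\<one> \<in> X"
  shows "alt_join_sum X S g = 0"
  using alt_join_sum_insert[OF assms(1), of \<one> S g] assms(2)
  by (simp add: alt_join_sum_insert_one insert_absorb)

lemma alt_join_sum_sum:
  "(\<Sum>i\<in>I. alt_join_sum X S (g i)) = alt_join_sum X S (\<lambda>r. \<Sum>i\<in>I. g i r)"
  unfolding alt_join_sum_def scaleR_sum_right by (rule sum.swap)

text \<open>Formally the inner product of \<open>V\<^sub>r V\<^sub>r\<^sup>* V\<^sub>q k\<close>
  with \<open>V\<^sub>p h\<close>; at the join of \<open>p\<close> and \<open>q\<close> it is the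
  kernel entry. It is meaningful only for common multiples of \<open>p\<close> and \<open>q\<close>,
  so \<open>gram\<close> puts both points into the second set.\<close>

definition pair_form ::
    "('a \<Rightarrow> 'h::chilbert_space \<Rightarrow> 'h) \<Rightarrow> 'a \<Rightarrow> 'h \<Rightarrow> 'a \<Rightarrow> 'h \<Rightarrow> 'a option \<Rightarrow> complex"
  where "pair_form T p h q k r =
    cinner (rep_adj T (map_option (left_quotient P q) r) k)
      (rep_adj T (map_option (left_quotient P p) r) h)"

text \<open>
  Formally \<open>\<parallel>\<Prod>\<^bsub>x\<in>X\<^esub> (1 - V\<^sub>x V\<^sub>x\<^sup>*) (\<Sum>\<^bsub>i<n\<^esub> V\<^bsub>p i\<^esub> (h i))\<parallel>\<^sup>2\<close> for a Nica covariant
  isometric dilation \<open>V\<close> of \<open>T\<close>.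
\<close>

definition gram ::
    "('a \<Rightarrow> 'h::chilbert_space \<Rightarrow> 'h) \<Rightarrow> 'a set \<Rightarrow> nat \<Rightarrow> (nat \<Rightarrow> 'a) \<Rightarrow> (nat \<Rightarrow> 'h) \<Rightarrow> complex"
  where "gram T X n p h =
    (\<Sum>i<n. \<Sum>j<n. alt_join_sum X {p i, p j} (pair_form T (p i) (h i) (p j) (h j)))"

lemma pair_form_None [simp]: "pair_form T p h q k None = 0"
  by (simp add: pair_form_def)

lemma left_quotient_mult_left:
  assumes "t divides r" "q \<in> carrier P" "t \<in> carrier P" "r \<in> carrier P"
  shows "left_quotient P (q \<otimes> t) (q \<otimes> r) = left_quotient P t r"
  using left_quotient_mult[of "q \<otimes> t" "left_quotient P t r"] left_quotient[OF assms(1,3)] assms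
  by (simp add: m_assoc)

section \<open>The kernel as a Gram form, and necessity of the condition\<close>

context
  fixes T :: "'a \<Rightarrow> 'h::chilbert_space \<Rightarrow> 'h"
  assumes rep: "unital_contractive_rep P T"
begin

lemma rep_clinear: "p \<in> carrier P \<Longrightarrow> bounded_clinear (T p)"
  using rep by (simp add: unital_contractive_rep_def)

lemma rep_ext_clinear: "set_option r \<subseteq> carrier P \<Longrightarrow> bounded_clinear (rep_ext T r)"
  by (cases r) (auto simp: rep_ext_def bounded_clinear_zero rep_clinear)

lemma rep_adj_clinear: "set_option r \<subseteq> carrier P \<Longrightarrow> bounded_clinear (rep_adj T r)"
  by (simp add: rep_adj_def bounded_clinear_cadjoint rep_ext_clinear)

lemma rep_adj_mult:
  assumes "p \<in> carrier P" "q \<in> carrier P"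
  shows "rep_adj T (Some (p \<otimes> q)) h = rep_adj T (Some q) (rep_adj T (Some p) h)"
  using rep assms by (simp add: rep_adj_Some unital_contractive_rep_def cadjoint_compose)

lemma rjoin_carrier: "finite F \<Longrightarrow> F \<subseteq> carrier P \<Longrightarrow> set_option (rjoin P F) \<subseteq> carrier P"
  by (auto intro: rjoin_SomeD(1))

lemma star_regular_kernel_clinear:
  assumes "p \<in> carrier P" "q \<in> carrier P"
  shows "bounded_clinear (star_regular_kernel P T p q)"
proof (cases "rjoin P {p, q}")
  case (Some s)
  have "left_quotient P p s \<in> carrier P" "left_quotient P q s \<in> carrier P"
    using rjoin_SomeD(3)[OF Some] assms left_quotient(1) by auto
  then show ?thesis
    using bounded_clinear_compose[OF rep_clinear bounded_clinear_cadjoint[OF rep_clinear]] Some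
    by (simp add: star_regular_kernel_def comp_def)
qed (simp add: star_regular_kernel_def bounded_clinear_zero)

lemma cinner_star_regular_kernel:
  assumes "p \<in> carrier P" "q \<in> carrier P"
  shows "cinner (star_regular_kernel P T p q k) h = pair_form T p h q k (rjoin P {p, q})"
proof (cases "rjoin P {p, q}")
  case (Some s)
  then have "left_quotient P p s \<in> carrier P"
    using rjoin_SomeD(3)[OF Some] assms left_quotient(1) by auto
  then show ?thesis
    using Some
    by (simp add: star_regular_kernel_def pair_form_def rep_adj_Some cinner_cadjoint rep_clinear)
qed (simp add: star_regular_kernel_def)

text \<open>With \<open>X\<close> empty, each alternating sum in \<open>gram\<close> has a single
  term, the one at the join of \<open>p i\<close> and \<open>p j\<close>.\<close>

lemma has_star_regular_dilation_iff_gram: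
  "has_star_regular_dilation P T \<longleftrightarrow>
    (\<forall>n p h. (\<forall>i<n. p i \<in> carrier P) \<longrightarrow> nonneg_complex (gram T {} n p h))"
proof -
  have "(\<Sum>i<n. cinner (\<Sum>j<n. star_regular_kernel P T (p i) (p j) (h j)) (h i)) = gram T {} n p h"
    if "\<forall>i<n. p i \<in> carrier P" for n p h
    unfolding gram_def cinner_sum_left
    by (intro sum.cong) (use that in \<open>auto simp: cinner_star_regular_kernel alt_join_sum_def\<close>)
  then show ?thesis
    using star_regular_kernel_clinear
    unfolding has_star_regular_dilation_def positive_op_matrix_def by auto
qed

lemma positive_op_iff_alt_join_sum:
  assumes "finite F" "F \<subseteq> carrier P"
  shows "positive_op (\<lambda>h. \<Sum>U\<in>Pow F. (-1) ^ card U *\<^sub>R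
      rep_ext T (rjoin P U) (cadjoint (rep_ext T (rjoin P U)) h)) \<longleftrightarrow>
    (\<forall>h. nonneg_complex (alt_join_sum F {} (range_form T h)))"
proof -
  have carr: "set_option (rjoin P U) \<subseteq> carrier P" if "U \<in> Pow F" for U
    using that assms finite_subset[of U F] by (intro rjoin_carrier) auto
  have "bounded_clinear (\<lambda>h. \<Sum>U\<in>Pow F. (-1) ^ card U *\<^sub>R
      rep_ext T (rjoin P U) (cadjoint (rep_ext T (rjoin P U)) h))"
    by (intro bounded_clinear_sum bounded_clinear_scaleR
        bounded_clinear_compose[OF rep_ext_clinear bounded_clinear_cadjoint[OF rep_ext_clinear]] carr)
  moreover have "cinner (\<Sum>U\<in>Pow F. (-1) ^ card U *\<^sub>R
      rep_ext T (rjoin P U) (cadjoint (rep_ext T (rjoin P U)) h)) h =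
      alt_join_sum F {} (range_form T h)" for h
    unfolding alt_join_sum_def cinner_sum_left cinner_scaleR_left
    by (intro sum.cong)
      (auto simp: range_form_def rep_adj_def cinner_cadjoint[OF rep_ext_clinear[OF carr]]
        scaleR_conv_of_real)
  ultimately show ?thesis
    by (simp add: positive_op_def)
qed

lemma range_form_nonneg_of_dilation:
  assumes "has_star_regular_dilation P T" "finite F" "F \<subseteq> carrier P"
  shows "nonneg_complex (alt_join_sum F {} (range_form T h))"
proof -
  let ?n = "card (Pow F)"
  obtain e where e: "bij_betw e {..<?n} (Pow F)"
    using ex_bij_betw_nat_finite[of "Pow F"] assms(2) by (auto simp: atLeast0LessThan)
  \<comment> \<open>The value at an infinite join is a placeholder: there \<open>k U = 0\<close>, so
    the point contributes nothing.\<close>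
  define p where "p U = (case rjoin P U of None \<Rightarrow> \<one> | Some u \<Rightarrow> u)" for U
  define k where "k U = (-1) ^ card U *\<^sub>R rep_adj T (rjoin P U) h" for U
  have sub: "finite U" "U \<subseteq> carrier P" if "U \<subseteq> F" for U
    using that assms finite_subset by auto
  have p_carrier: "p U \<in> carrier P" if "U \<subseteq> F" for U
    using rjoin_carrier[OF sub[OF that]] by (auto simp: p_def split: option.splits)
  have form: "pair_form T (p U) (k U) (p W) (k W) (rjoin P {p U, p W}) =
      (-1) ^ card W *\<^sub>R (-1) ^ card U *\<^sub>R range_form T h (rjoin P (W \<union> U))"
    if UW: "U \<subseteq> F" "W \<subseteq> F" for U W
  proof (cases "rjoin P (W \<union> U)")
    case None
    then have ub: "upper_bounds (W \<union> U) = {}"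
      by (simp add: rjoin_eq_None_iff)
    show ?thesis
    proof (cases "rjoin P {p U, p W}")
      case (Some s)
      \<comment> \<open>If both points were true joins, \<open>s\<close> would be an upper bound of
        \<open>W \<union> U\<close>; so one is a placeholder with vector 0.\<close>
      have "rjoin P U = None \<or> rjoin P W = None"
      proof (rule ccontr)
        assume "\<not> ?thesis"
        then have "rjoin P U = Some (p U)" "rjoin P W = Some (p W)"
          by (auto simp: p_def)
        then have "upper_bounds U = upper_bounds {p U}" "upper_bounds W = upper_bounds {p W}"
          using rjoin_SomeD(2) sub UW by blast+
        then have "upper_bounds {p U, p W} = {}"
          using ub upper_bounds_Un[of "{p U}" "{p W}"] upper_bounds_Un[of U W]
          by (simp add: Un_commute insert_commute)
        then show False
          using Some by (simp flip: rjoin_eq_None_iff)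
      qed
      then have "k U = 0 \<or> k W = 0"
        by (auto simp: k_def)
      moreover have "left_quotient P (p U) s \<in> carrier P" "left_quotient P (p W) s \<in> carrier P"
        using rjoin_SomeD(3)[OF Some] p_carrier UW left_quotient(1) by auto
      then have "rep_adj T (Some (left_quotient P (p U) s)) 0 = 0"
        "rep_adj T (Some (left_quotient P (p W) s)) 0 = 0"
        by (auto intro!: bounded_clinearD(4) rep_adj_clinear)
      ultimately have "pair_form T (p U) (k U) (p W) (k W) (Some s) = 0"
        by (auto simp: pair_form_def)
      then show ?thesis
        using None Some by (simp add: range_form_def)
    qed (simp add: None range_form_def)
  next
    case (Some s)
    have carr: "finite (W \<union> U)" "W \<union> U \<subseteq> carrier P"
      using sub UW by auto
    have s: "s \<in> carrier P" "upper_bounds (W \<union> U) = upper_bounds {s}"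
      using rjoin_SomeD[OF Some carr] by auto
    then have "s \<in> upper_bounds (W \<union> U)"
      by (simp add: upper_bounds_def)
    then have "upper_bounds U \<noteq> {}" "upper_bounds W \<noteq> {}"
      by (auto simp: upper_bounds_def)
    then have "rjoin P U = Some (p U)" "rjoin P W = Some (p W)"
      by (auto simp: p_def simp flip: rjoin_eq_None_iff)
    note pU = this
    then have ub: "upper_bounds U = upper_bounds {p U}" "upper_bounds W = upper_bounds {p W}"
      using rjoin_SomeD(2) sub UW by blast+
    then have "upper_bounds {p U, p W} = upper_bounds (W \<union> U)"
      using upper_bounds_Un[of "{p U}" "{p W}"] upper_bounds_Un[of U W]
      by (simp add: Un_commute insert_commute)
    then have join: "rjoin P {p U, p W} = Some s"
      using Some rjoin_cong by metis
    \<comment> \<open>The adjoints at \<open>p V\<close> and at the quotient compose to the adjoint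
      at \<open>s\<close>, so up to signs the entry depends only on
      \<open>W \<union> U\<close>.\<close>
    have adj: "rep_adj T (Some (left_quotient P (p V) s)) (k V) =
        (-1) ^ card V *\<^sub>R rep_adj T (Some s) h" if "V \<in> {U, W}" for V
    proof -
      have V: "p V divides s" "p V \<in> carrier P" "rjoin P V = Some (p V)"
        using rjoin_SomeD(3)[OF join] p_carrier UW that pU by auto
      note lq = left_quotient[OF V(1,2)]
      have "bounded_linear (rep_adj T (Some (left_quotient P (p V) s)))"
        using lq by (intro bounded_clinearD(1) rep_adj_clinear) auto
      then show ?thesis
        using rep_adj_mult[OF V(2) lq(1), of h] lq(2) V(3)
        by (simp add: k_def linear_cmul bounded_linear.linear)
    qed
    show ?thesis
      using Some join adj
      by (simp add: pair_form_def range_form_def cinner_scaleR_left cinner_scaleR_right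
          scaleR_conv_of_real)
  qed
  have "gram T {} ?n (p \<circ> e) (k \<circ> e) =
      (\<Sum>U\<in>Pow F. \<Sum>W\<in>Pow F. pair_form T (p U) (k U) (p W) (k W) (rjoin P {p U, p W}))"
    by (simp add: gram_def alt_join_sum_def flip: sum.reindex_bij_betw[OF e])
  also have "\<dots> = (\<Sum>U\<in>Pow F. \<Sum>W\<in>Pow F.
      (-1) ^ card W *\<^sub>R (-1) ^ card U *\<^sub>R range_form T h (rjoin P (W \<union> U)))"
    by (intro sum.cong refl form) auto
  \<comment> \<open>Exchanging the sums collects the terms with fixed \<open>W\<close> into one
    alternating sum, ready for idempotence.\<close>
  also have "\<dots> = (\<Sum>W\<in>Pow F. (-1) ^ card W *\<^sub>R alt_join_sum F W (range_form T h))"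
    unfolding alt_join_sum_def scaleR_sum_right by (rule sum.swap)
  also have "\<dots> = alt_join_sum F {} (range_form T h)"
    by (rule alt_join_sum_idem[OF assms(2,3)])
  finally show ?thesis
    using assms(1) p_carrier bij_betwE[OF e]
    unfolding has_star_regular_dilation_iff_gram by (metis Pow_iff comp_apply lessThan_iff)
qed

end

end


section \<open>Reduction to a generating set\<close>

text \<open>
  The length is not required to be additive or monotone; passing from \<open>x\<close> to \<open>q\<^sup>-\<^sup>1 (q \<or> x)\<close>
  must not increase it, which is what makes the inductions below terminate.
\<close>

locale generated_lcm_monoid = right_lcm_monoid P for P (structure) +
  fixes P0 :: "'a set" and len :: "'a \<Rightarrow> nat"
  assumes P0_carrier: "P0 \<subseteq> carrier P"
    and len_one: "len \<one> = 0"
    and len_P0: "q \<in> P0 \<Longrightarrow> 0 < len q"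
    and len_factor: "\<lbrakk>x \<in> carrier P; x \<noteq> \<one>; x \<notin> P0\<rbrakk> \<Longrightarrow>
      \<exists>q\<in>P0. \<exists>r\<in>carrier P. x = q \<otimes> r \<and> len q < len x \<and> len r < len x"
    and len_resid: "\<lbrakk>q \<in> P0; x \<in> carrier P; t \<in> carrier P;
      \<forall>u\<in>carrier P. x divides q \<otimes> u \<longleftrightarrow> t divides u\<rbrakk> \<Longrightarrow> len t \<le> len x"
begin

text \<open>\<open>len_resid\<close> speaks of any \<open>t\<close> with the universal property of
  the residual, so that a concrete monoid can check it by divisibility alone;
  \<open>resid q x\<close> is such a \<open>t\<close>.\<close>

lemma len_resid_le:
  assumes "q \<in> P0" "x \<in> carrier P" "compat q x"
  shows "len (resid q x) \<le> len x"
  using len_resid[OF assms(1,2)] resid[OF assms(3)] assms P0_carrier by blast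

context
  fixes T :: "'a \<Rightarrow> 'h::chilbert_space \<Rightarrow> 'h"
  assumes rep: "unital_contractive_rep P T"
    and P0_nonneg: "\<And>F h. \<lbrakk>finite F; F \<subseteq> P0\<rbrakk> \<Longrightarrow>
      nonneg_complex (alt_join_sum F {} (range_form T h))"
begin

text \<open>
  For \<open>x = q r\<close> the induction rests on
  \<open>1 - V\<^sub>x V\<^sub>x\<^sup>* = (1 - V\<^sub>q V\<^sub>q\<^sup>*) + V\<^sub>q (1 - V\<^sub>r V\<^sub>r\<^sup>*) V\<^sub>q\<^sup>*\<close>.
\<close>

lemma range_form_nonneg:
  assumes "finite X" "X \<subseteq> carrier P"
  shows "nonneg_complex (alt_join_sum X {} (range_form T h))"
  using assms
proof (induction "\<Sum>x\<in>X. len x" arbitrary: X h rule: less_induct)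
  case less
  consider "\<one> \<in> X" | "X \<subseteq> P0" | x where "x \<in> X" "x \<noteq> \<one>" "x \<notin> P0"
    by blast
  then show ?case
  proof cases
    case 1
    then show ?thesis
      using alt_join_sum_one_mem[OF less.prems(1), of "{}" "range_form T h"] by (simp add: nonneg_complex_def)
  next
    case 2
    then show ?thesis
      using P0_nonneg less.prems by blast
  next
    case 3
    define Y where "Y = X - {x}"
    have Y: "X = insert x Y" "x \<notin> Y" "finite Y" "Y \<subseteq> carrier P" "x \<in> carrier P"
      using 3 less.prems by (auto simp: Y_def)
    obtain q r where qr: "q \<in> P0" "r \<in> carrier P" "x = q \<otimes> r" "len q < len x" "len r < len x"
      using len_factor[OF Y(5) 3(2,3)] by blast
    have q: "q \<in> carrier P"
      using qr(1) P0_carrier by blast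
    define Z where "Z = resid q ` {y \<in> Y. compat q y}"
    have Z: "finite Z" "Z \<subseteq> carrier P"
      using Y q resid(1) by (auto simp: Z_def)
    let ?g = "range_form T h"
    let ?g' = "range_form T (rep_adj T (Some q) h)"
    have "q divides x"
      using qr by (auto simp: factor_def)
    then have red: "alt_join_sum Y {q, x} ?g = alt_join_sum Y {x} ?g"
      using q by (intro alt_join_sum_insert_redundant[of q x]) auto
    have "{y \<in> insert x Y. compat q y} = insert x {y \<in> Y. compat q y}"
      using resid_mult[OF q qr(2)] qr(3) by auto
    then have "resid q ` {y \<in> insert x Y. compat q y} = insert r Z"
      using resid_mult[OF q qr(2)] qr(3) by (simp add: Z_def)
    \<comment> \<open>Shifting along \<open>q\<close> moves its adjoint onto the vector: the same
      kind of form results at \<open>rep_adj T (Some q) h\<close>, with \<open>r\<close> in place of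
      \<open>x\<close>.\<close>
    then have "alt_join_sum (insert x Y) {q} ?g =
        alt_join_sum (insert r Z) {} (?g \<circ> map_option (\<lambda>t. q \<otimes> t))"
      using alt_join_sum_shift[of "insert x Y" "{}" q ?g] Y q by (simp add: range_form_def)
    also have "\<dots> = alt_join_sum (insert r Z) {} ?g'"
      by (rule alt_join_sum_cong_carrier)
        (use Z qr q in \<open>auto simp: range_form_def rep_adj_mult[OF rep]\<close>)
    finally have "alt_join_sum X {} ?g =
        alt_join_sum (insert q Y) {} ?g + alt_join_sum (insert r Z) {} ?g'"
      using red Y by (simp add: alt_join_sum_insert insert_commute algebra_simps)
    moreover have "(\<Sum>y\<in>insert q Y. len y) < (\<Sum>y\<in>X. len y)"
      using Y qr(4) by (simp add: sum.insert_if)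
    moreover have "(\<Sum>y\<in>insert r Z. len y) < (\<Sum>y\<in>X. len y)"
    proof -
      \<comment> \<open>Distinct elements may share a residual, so the sum over the image is only
        bounded by the sum over \<open>Y\<close>.\<close>
      have "(\<Sum>y\<in>Z. len y) \<le> (\<Sum>y\<in>{y \<in> Y. compat q y}. len (resid q y))"
        unfolding Z_def using Y(3) sum_image_le[of "{y \<in> Y. compat q y}" len "resid q"]
        by (simp add: comp_def)
      also have "\<dots> \<le> (\<Sum>y\<in>{y \<in> Y. compat q y}. len y)"
        using Y(4) qr(1) by (intro sum_mono len_resid_le) auto
      also have "\<dots> \<le> (\<Sum>y\<in>Y. len y)"
        using Y(3) by (intro sum_mono2) auto
      finally show ?thesis
        using Y qr(5) Z by (simp add: sum.insert_if)
    qed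
    ultimately show ?thesis
      using less.hyps[of "insert q Y" h] less.hyps[of "insert r Z" "rep_adj T (Some q) h"]
        Y Z q qr(2) by (simp add: nonneg_complex_add)
  qed
qed

text \<open>With trivial points the formal vector is \<open>\<Sum>i<n. h i\<close> in the original
  space, and sesquilinearity turns \<open>gram\<close> into one alternating sum of
  \<open>range_form\<close>.\<close>

lemma gram_nonneg_ones:
  assumes "finite X" "X \<subseteq> carrier P" "\<forall>i<n. p i = \<one>"
  shows "nonneg_complex (gram T X n p h)"
proof -
  have "alt_join_sum X {p i, p j} (pair_form T (p i) (h i) (p j) (h j)) =
      alt_join_sum X {} (\<lambda>r. cinner (rep_adj T r (h j)) (rep_adj T r (h i)))"
    if "i < n" "j < n" for i j
  proof -
    have "alt_join_sum X {} (pair_form T \<one> (h i) \<one> (h j)) =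
        alt_join_sum X {} (\<lambda>r. cinner (rep_adj T r (h j)) (rep_adj T r (h i)))"
      by (rule alt_join_sum_cong_carrier)
        (use assms in \<open>auto simp: pair_form_def left_quotient_one\<close>)
    then show ?thesis
      using assms(3) that by (simp add: alt_join_sum_insert_one)
  qed
  then have "gram T X n p h = alt_join_sum X {}
      (\<lambda>r. \<Sum>i<n. \<Sum>j<n. cinner (rep_adj T r (h j)) (rep_adj T r (h i)))"
    by (simp add: gram_def alt_join_sum_sum)
  also have "\<dots> = alt_join_sum X {} (range_form T (\<Sum>i<n. h i))"
  proof (rule alt_join_sum_cong_carrier)
    fix r assume "r \<in> carrier P"
    then have "rep_adj T (Some r) (\<Sum>i<n. h i) = (\<Sum>i<n. rep_adj T (Some r) (h i))"
      by (intro bounded_clinearD(5) rep_adj_clinear[OF rep]) auto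
    then show "(\<Sum>i<n. \<Sum>j<n. cinner (rep_adj T (Some r) (h j)) (rep_adj T (Some r) (h i))) =
        range_form T (\<Sum>i<n. h i) (Some r)"
      by (simp add: range_form_def cinner_sum_left cinner_sum_right)
  qed (use assms in \<open>auto simp: range_form_def\<close>)
  finally show ?thesis
    using range_form_nonneg assms by simp
qed

lemma alt_join_sum_pair_form_zero:
  assumes "finite X" "X \<subseteq> carrier P" "p \<in> carrier P" "q \<in> carrier P" "h = 0 \<or> k = 0"
  shows "alt_join_sum X {p, q} (pair_form T p h q k) = 0"
proof -
  have "alt_join_sum X {p, q} (pair_form T p h q k) = alt_join_sum X {p, q} (\<lambda>r. 0)"
  proof (rule alt_join_sum_cong_carrier)
    fix r assume "r \<in> carrier P" "\<forall>x\<in>{p, q}. x divides r"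
    then have "left_quotient P p r \<in> carrier P" "left_quotient P q r \<in> carrier P"
      using left_quotient(1) assms by auto
    then show "pair_form T p h q k (Some r) = 0"
      using assms(5) rep_adj_clinear[OF rep] by (auto simp: pair_form_def bounded_clinearD(4))
  qed (use assms in auto)
  then show ?thesis
    by (simp add: alt_join_sum_zero)
qed

text \<open>Formally \<open>V\<^sub>q\<^sup>* V\<^sub>p h\<close> is \<open>V\<^sub>t\<close>
  applied to the inner vector on the right, where \<open>t = resid q p\<close>. The quotient of
  \<open>q \<otimes> r\<close> by \<open>p\<close> factors through the join
  \<open>q \<otimes> t\<close>.\<close>

lemma rep_adj_left_quotient_shift:
  assumes "q \<in> carrier P" "p \<in> carrier P" "compat q p" "r \<in> carrier P" "resid q p divides r"
  shows "rep_adj T (Some (left_quotient P p (q \<otimes> r))) h =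
    rep_adj T (Some (left_quotient P (resid q p) r))
      (rep_adj T (Some (left_quotient P p (q \<otimes> resid q p))) h)"
proof -
  note rs = resid[OF assms(3,1,2)]
  have "q \<otimes> resid q p divides q \<otimes> r"
    using divides_mult_left rs(1) assms by blast
  then have "left_quotient P p (q \<otimes> r) =
      left_quotient P p (q \<otimes> resid q p) \<otimes> left_quotient P (resid q p) r"
    using left_quotient_trans[OF rs(4), of "q \<otimes> r"] left_quotient_mult_left[OF assms(5,1) rs(1) assms(4)] rs(1) assms
    by simp
  then show ?thesis
    using rep_adj_mult[OF rep] left_quotient(1)[OF rs(4) assms(2)] left_quotient(1)[OF assms(5) rs(1)]
    by simp
qed

text \<open>
  The vector \<open>v = \<Sum>\<^bsub>i<n\<^esub> V\<^bsub>p i\<^esub> (h i)\<close> is split along \<open>1 = (1 - V\<^sub>q V\<^sub>q\<^sup>*) + V\<^sub>q V\<^sub>q\<^sup>*\<close>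
  for a generator \<open>q\<close> dividing some \<open>p i\<close>: the first part no longer involves the \<open>p i\<close>
  divisible by \<open>q\<close>, and \<open>V\<^sub>q\<^sup>* v\<close> has shorter \<open>p i\<close>.  An index \<open>i\<close> that disappears is
  kept with \<open>p i = 1\<close> and \<open>h i = 0\<close>.
\<close>

lemma gram_nonneg:
  assumes "finite X" "X \<subseteq> carrier P" "\<forall>i<n. p i \<in> carrier P"
  shows "nonneg_complex (gram T X n p h)"
  using assms
proof (induction "\<Sum>i<n. len (p i)" arbitrary: X p h rule: less_induct)
  case less
  show ?case
  proof (cases "\<forall>i<n. p i = \<one>")
    case True
    then show ?thesis
      using gram_nonneg_ones less.prems by blast
  next
    case False
    then obtain m where m: "m < n" "p m \<noteq> \<one>" by blast
    \<comment> \<open>If \<open>p m\<close> is itself a generator, it is split with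
      \<open>r = \<one>\<close>, of length 0.\<close>
    obtain q r where qr: "q \<in> P0" "r \<in> carrier P" "p m = q \<otimes> r" "len r < len (p m)"
    proof (cases "p m \<in> P0")
      case True
      then show ?thesis
        using that[of "p m" \<one>] P0_carrier len_P0 len_one by auto
    next
      case False
      then show ?thesis
        using that len_factor[of "p m"] m less.prems(3) by metis
    qed
    have q: "q \<in> carrier P"
      using qr(1) P0_carrier by blast
    have p: "p i \<in> carrier P" if "i < n" for i
      using less.prems that by blast

    \<comment> \<open>The factor \<open>1 - V\<^sub>q V\<^sub>q\<^sup>*\<close> annihilates every
      summand whose point is divisible by \<open>q\<close>, so these summands may be set to zero at
      the point \<open>\<one>\<close>.\<close>
    define p1 where "p1 i = (if q divides p i then \<one> else p i)" for i
    define h1 where "h1 i = (if q divides p i then 0 else h i)" for i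
    have "alt_join_sum (insert q X) {p i, p j} (pair_form T (p i) (h i) (p j) (h j)) =
        alt_join_sum (insert q X) {p1 i, p1 j} (pair_form T (p1 i) (h1 i) (p1 j) (h1 j))"
      if "i < n" "j < n" for i j
    proof (cases "q divides p i \<or> q divides p j")
      case True
      then have "alt_join_sum (insert q X) {p1 i, p1 j} (pair_form T (p1 i) (h1 i) (p1 j) (h1 j)) = 0"
        using p that q less.prems by (intro alt_join_sum_pair_form_zero) (auto simp: p1_def h1_def)
      moreover have "alt_join_sum (insert q X) {p i, p j} g = 0" for g :: "'a option \<Rightarrow> complex"
        using True q less.prems(1)
          alt_join_sum_eq_zero[of "insert q X" q "p i" "{p i, p j}" g]
          alt_join_sum_eq_zero[of "insert q X" q "p j" "{p i, p j}" g] by auto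
      ultimately show ?thesis by simp
    qed (simp add: p1_def h1_def)
    then have gram1: "gram T (insert q X) n p h = gram T (insert q X) n p1 h1"
      by (simp add: gram_def)
    have "(\<Sum>i<n. len (p1 i)) < (\<Sum>i<n. len (p i))"
    proof (rule sum_strict_mono_ex1)
      have "q divides p m"
        using qr by (auto simp: factor_def)
      then show "\<exists>i\<in>{..<n}. len (p1 i) < len (p i)"
        using m(1) qr(4) by (intro bexI[of _ m]) (auto simp: p1_def len_one)
    qed (auto simp: p1_def len_one)
    then have nonneg1: "nonneg_complex (gram T (insert q X) n p h)"
      unfolding gram1 using less.prems q p by (intro less.hyps) (auto simp: p1_def)

    \<comment> \<open>\<open>p2 i\<close> and \<open>h2 i\<close> describe the image of the summand
      at \<open>p i\<close> under the adjoint of \<open>V\<^sub>q\<close>, which is 0 for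
      incompatible \<open>p i\<close>.\<close>
    define p2 where "p2 i = (if compat q (p i) then resid q (p i) else \<one>)" for i
    define h2 where "h2 i = (if compat q (p i)
      then rep_adj T (Some (left_quotient P (p i) (q \<otimes> resid q (p i)))) (h i) else 0)" for i
    define Y where "Y = resid q ` {x \<in> X. compat q x}"
    have Y: "finite Y" "Y \<subseteq> carrier P"
      using less.prems q resid(1) by (auto simp: Y_def)
    have p2: "p2 i \<in> carrier P" if "i < n" for i
      using resid(1)[OF _ q p[OF that]] by (simp add: p2_def)
    have "alt_join_sum X (insert q {p i, p j}) (pair_form T (p i) (h i) (p j) (h j)) =
        alt_join_sum Y {p2 i, p2 j} (pair_form T (p2 i) (h2 i) (p2 j) (h2 j))"
      if ij: "i < n" "j < n" for i j
    proof (cases "compat q (p i) \<and> compat q (p j)")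
      case True
      let ?f = "pair_form T (p i) (h i) (p j) (h j)"
      have "alt_join_sum X (insert q {p i, p j}) ?f =
          alt_join_sum Y {p2 i, p2 j} (?f \<circ> map_option (\<lambda>t. q \<otimes> t))"
        using alt_join_sum_shift[of X "{p i, p j}" q ?f] less.prems p q ij True
        by (simp add: Y_def p2_def)
      also have "\<dots> = alt_join_sum Y {p2 i, p2 j} (pair_form T (p2 i) (h2 i) (p2 j) (h2 j))"
      proof (rule alt_join_sum_cong_carrier)
        fix r assume "r \<in> carrier P" "\<forall>x\<in>{p2 i, p2 j}. x divides r"
        then show "(?f \<circ> map_option (\<lambda>t. q \<otimes> t)) (Some r) =
            pair_form T (p2 i) (h2 i) (p2 j) (h2 j) (Some r)"
          using ij True p q by (simp add: pair_form_def p2_def h2_def rep_adj_left_quotient_shift)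
      qed (use Y p2 ij in auto)
      finally show ?thesis .
    next
      case False
      let ?f = "pair_form T (p i) (h i) (p j) (h j)"
      have "alt_join_sum Y {p2 i, p2 j} (pair_form T (p2 i) (h2 i) (p2 j) (h2 j)) = 0"
        using False Y p2 ij by (intro alt_join_sum_pair_form_zero) (auto simp: h2_def)
      moreover have "alt_join_sum X (insert q {p i, p j}) ?f = 0"
        using False
          alt_join_sum_incompatible[of ?f q "insert q {p i, p j}" "p i"]
          alt_join_sum_incompatible[of ?f q "insert q {p i, p j}" "p j"] by auto
      ultimately show ?thesis by simp
    qed
    then have gram2: "(\<Sum>i<n. \<Sum>j<n.
        alt_join_sum X (insert q {p i, p j}) (pair_form T (p i) (h i) (p j) (h j))) =
        gram T Y n p2 h2"
      by (simp add: gram_def)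
    have "(\<Sum>i<n. len (p2 i)) < (\<Sum>i<n. len (p i))"
    proof (rule sum_strict_mono_ex1)
      \<comment> \<open>At the index \<open>m\<close> the residual is \<open>r\<close>.\<close>
      show "\<exists>i\<in>{..<n}. len (p2 i) < len (p i)"
        using m(1) qr resid_mult[OF q qr(2)] by (intro bexI[of _ m]) (auto simp: p2_def)
      show "\<forall>i\<in>{..<n}. len (p2 i) \<le> len (p i)"
        using len_resid_le[OF qr(1) p] by (auto simp: p2_def len_one)
    qed auto
    then have nonneg2: "nonneg_complex (gram T Y n p2 h2)"
      using Y p2 by (intro less.hyps) auto

    have "gram T X n p h = gram T (insert q X) n p h + gram T Y n p2 h2"
      unfolding gram2[symmetric] using less.prems(1)
      by (simp add: gram_def alt_join_sum_insert flip: sum.distrib)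
    then show ?thesis
      using nonneg1 nonneg2 nonneg_complex_add by simp
  qed
qed

end

theorem has_star_regular_dilation_iff:
  fixes T :: "'a \<Rightarrow> 'h::chilbert_space \<Rightarrow> 'h"
  assumes "unital_contractive_rep P T"
  shows "has_star_regular_dilation P T \<longleftrightarrow>
    (\<forall>F. finite F \<and> F \<subseteq> P0 \<longrightarrow>
      positive_op (\<lambda>h. \<Sum>U\<in>Pow F. (-1) ^ card U *\<^sub>R
        rep_ext T (rjoin P U) (cadjoint (rep_ext T (rjoin P U)) h)))"
proof -
  have "positive_op (\<lambda>h. \<Sum>U\<in>Pow F. (-1) ^ card U *\<^sub>R
        rep_ext T (rjoin P U) (cadjoint (rep_ext T (rjoin P U)) h)) \<longleftrightarrow>
      (\<forall>h. nonneg_complex (alt_join_sum F {} (range_form T h)))"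
    if "finite F" "F \<subseteq> P0" for F
    using positive_op_iff_alt_join_sum[OF assms] that P0_carrier by auto
  moreover have "nonneg_complex (alt_join_sum F {} (range_form T h))"
    if "has_star_regular_dilation P T" "finite F" "F \<subseteq> P0" for F h
    using range_form_nonneg_of_dilation[OF assms] that P0_carrier by auto
  moreover have "has_star_regular_dilation P T"
    if "\<And>F h. \<lbrakk>finite F; F \<subseteq> P0\<rbrakk> \<Longrightarrow> nonneg_complex (alt_join_sum F {} (range_form T h))"
    using has_star_regular_dilation_iff_gram[OF assms] gram_nonneg[OF assms that, of "{}"] by auto
  ultimately show ?thesis by blast
qed

end


section \<open>The monoid \<open>\<nat> \<rtimes> \<nat>\<^sup>\<times>\<close>\<close>

lemma nat_affine_simps [simp]:
  "(a, m) \<in> carrier nat_affine \<longleftrightarrow> 1 \<le> m"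
  "(a, m) \<otimes>\<^bsub>nat_affine\<^esub> (b, n) = (a + b * m, m * n)"
  "\<one>\<^bsub>nat_affine\<^esub> = (0, 1)"
  by (auto simp: nat_affine_def)

section \<open>Divisibility, length and residuals of affine maps\<close>

lemma nat_affine_divides_iff:
  assumes "1 \<le> k"
  shows "(a, m) divides\<^bsub>nat_affine\<^esub> (c, k) \<longleftrightarrow> a \<le> c \<and> m dvd c - a \<and> m dvd k"
proof
  assume "a \<le> c \<and> m dvd c - a \<and> m dvd k"
  then obtain b n where "c - a = m * b" "k = m * n"
    by (auto elim!: dvdE)
  then have "c = a + b * m" "k = m * n"
    using \<open>a \<le> c \<and> _\<close> by (simp_all add: mult.commute)
  then show "(a, m) divides\<^bsub>nat_affine\<^esub> (c, k)"
    using assms \<open>a \<le> c \<and> _\<close> unfolding factor_def by (intro bexI[of _ "(b, n)"]) auto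
qed (auto simp: factor_def)

text \<open>Splitting off \<open>(a mod p, p)\<close> for the prime factors \<open>p\<close> of
  \<open>m\<close> one by one leaves \<open>(a div m, 1)\<close>, a power of \<open>(1, 1)\<close>;
  the length counts the generators so obtained.\<close>

definition nat_affine_len :: "nat \<times> nat \<Rightarrow> nat"
  where "nat_affine_len x = fst x div snd x + size (prime_factorization (snd x))"

text \<open>Two upward arithmetic progressions that meet share a progression with step
  \<open>lcm m n\<close> that starts at their least common element.\<close>

lemma nat_affine_right_lcm:
  assumes "1 \<le> m" "1 \<le> n"
    and "a \<le> c \<and> m dvd c - a" "b \<le> c \<and> n dvd c - b"
  shows "\<exists>r\<in>carrier nat_affine. \<forall>u\<in>carrier nat_affine.
    ((a, m) divides\<^bsub>nat_affine\<^esub> u \<and> (b, n) divides\<^bsub>nat_affine\<^esub> u) \<longleftrightarrow> r divides\<^bsub>nat_affine\<^esub> u"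
proof -
  define Q where "Q x \<longleftrightarrow> (a \<le> x \<and> m dvd x - a) \<and> (b \<le> x \<and> n dvd x - b)" for x
  define l where "l = (LEAST x. Q x)"
  have Ql: "Q l"
    unfolding l_def using assms by (intro LeastI[of Q c]) (simp add: Q_def)
  have iff: "Q d \<longleftrightarrow> l \<le> d \<and> lcm m n dvd d - l" for d
  proof
    assume "Q d"
    then have "l \<le> d"
      unfolding l_def by (rule Least_le)
    moreover have "d - l = (d - a) - (l - a)" "d - l = (d - b) - (l - b)"
      using \<open>Q d\<close> Ql \<open>l \<le> d\<close> by (auto simp: Q_def)
    ultimately show "l \<le> d \<and> lcm m n dvd d - l"
      using \<open>Q d\<close> Ql by (metis Q_def dvd_diff_nat lcm_least)
  next
    assume d: "l \<le> d \<and> lcm m n dvd d - l"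
    then have "m dvd d - l" "n dvd d - l"
      using dvd_lcm1 dvd_lcm2 dvd_trans by blast+
    moreover have "d - a = (d - l) + (l - a)" "d - b = (d - l) + (l - b)"
      using d Ql by (auto simp: Q_def)
    ultimately have "m dvd d - a" "n dvd d - b"
      using Ql by (auto simp only: Q_def intro: dvd_add)
    then show "Q d"
      using d Ql by (auto simp: Q_def)
  qed
  show ?thesis
  proof (intro bexI[of _ "(l, lcm m n)"] ballI)
    show "(l, lcm m n) \<in> carrier nat_affine"
      using assms lcm_pos_nat[of m n] by simp
    fix u assume "u \<in> carrier nat_affine"
    then show "((a, m) divides\<^bsub>nat_affine\<^esub> u \<and> (b, n) divides\<^bsub>nat_affine\<^esub> u) \<longleftrightarrow>
        (l, lcm m n) divides\<^bsub>nat_affine\<^esub> u"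
      using iff[of "fst u"] by (cases u) (auto simp: nat_affine_divides_iff Q_def)
  qed
qed

text \<open>For \<open>m = 1\<close> the factor \<open>(1, 1)\<close> splits off; otherwise dividing
  \<open>a\<close> by a prime factor \<open>p\<close> of \<open>m\<close> gives the factors
  \<open>(a mod p, p)\<close> and \<open>(a div p, m div p)\<close>.\<close>

lemma nat_affine_factor:
  assumes "1 \<le> m" "(a, m) \<noteq> (0, 1)" "(a, m) \<notin> nat_affine_P0"
  shows "\<exists>q\<in>nat_affine_P0. \<exists>r\<in>carrier nat_affine. (a, m) = q \<otimes>\<^bsub>nat_affine\<^esub> r \<and>
    nat_affine_len q < nat_affine_len (a, m) \<and> nat_affine_len r < nat_affine_len (a, m)"
proof (cases "m = 1")
  case True
  then have "2 \<le> a"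
    using assms by (cases "a = 1") (auto simp: nat_affine_P0_def)
  then show ?thesis
    using True
    by (intro bexI[of _ "(1, 1)"] bexI[of _ "(a - 1, 1)"])
      (auto simp: nat_affine_P0_def nat_affine_len_def)
next
  case False
  then obtain p where p: "Factorial_Ring.prime p" "p dvd m"
    using prime_factor_nat by blast
  then obtain n where n: "m = p * n"
    by blast
  have "0 < n" "0 < p"
    using n assms(1) by (auto intro: gr0I)
  then have size: "size (prime_factorization m) = Suc (size (prime_factorization n))"
    using p by (simp add: n prime_factorization_mult prime_factorization_prime)
  have div: "a div p div n = a div m"
    by (simp add: n div_mult2_eq)
  \<comment> \<open>The left factor has length 1, so \<open>(a, m)\<close> needs length at least 2;
    here length 1 occurs only for generators.\<close>
  have "0 < a div m + size (prime_factorization n)"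
  proof (rule ccontr)
    assume "\<not> ?thesis"
    then have "a div m = 0" "n = 1"
      using \<open>0 < n\<close> by (auto simp: prime_factorization_empty_iff)
    then have "a < p" "m = p"
      using n \<open>0 < p\<close> by (auto simp: div_eq_0_iff)
    then show False
      using assms(3) p by (simp add: nat_affine_P0_def)
  qed
  then show ?thesis
    using p \<open>0 < n\<close> \<open>0 < p\<close> size div
    by (intro bexI[of _ "(a mod p, p)"] bexI[of _ "(a div p, n)"])
      (auto simp: nat_affine_P0_def nat_affine_len_def n prime_factorization_prime)
qed

text \<open>\<open>H\<close> is the universal property of the residual \<open>(b, n)\<close> of
  \<open>(a, m)\<close> by \<open>(i, p)\<close>, so \<open>b\<close> is the least admissible
  \<open>c\<close>. If \<open>m \<le> b\<close>, then \<open>b - m\<close> keeps the congruence and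
  must fail the inequality; the gap is a positive multiple of \<open>m\<close>, which gives
  \<open>b \<le> a\<close>.\<close>

lemma resid_coprime_bound:
  fixes a b i m n p :: nat
  assumes "1 \<le> p" "1 \<le> m" "1 \<le> n" "coprime m p"
    and H: "\<And>c k. 1 \<le> k \<Longrightarrow>
      (a \<le> i + c * p \<and> m dvd i + c * p - a \<and> m dvd p * k) \<longleftrightarrow> (b \<le> c \<and> n dvd c - b \<and> n dvd k)"
  shows "n = m" "b div m \<le> a div m"
proof -
  have b: "a \<le> i + b * p" "m dvd i + b * p - a" "m dvd p * n"
    using H[where k=n and c=b] assms(1-4) by auto
  then have "m dvd n"
    using assms by (simp add: coprime_dvd_mult_right_iff)
  moreover have "n dvd m"
    using H[where k=m and c=b] b assms(1-4) by auto
  ultimately show "n = m"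
    by (simp add: dvd_antisym)
  show "b div m \<le> a div m"
  proof (cases "b < m")
    case False
    define d where "d = b - m"
    have d: "b = d + m" "\<not> b \<le> d"
      using False assms by (auto simp: d_def)
    have ib: "i + b * p = (i + d * p) + m * p"
      by (simp add: d algebra_simps)
    have no: "\<not> (a \<le> i + d * p \<and> m dvd i + d * p - a)"
      using H[where k=m and c=d] d assms(1-4) by auto
    have "i + d * p < a"
    proof (rule ccontr)
      assume "\<not> ?thesis"
      moreover from this have "i + d * p - a = (i + b * p - a) - m * p"
        by (simp add: ib)
      moreover have "m dvd (i + b * p - a) - m * p"
        using b(2) by (rule dvd_diff_nat) simp
      ultimately show False
        using no by simp
    qed
    then have "a - (i + d * p) = m * p - (i + b * p - a)"
      using b(1) by (simp add: ib)
    moreover have "m dvd m * p - (i + b * p - a)"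
      by (rule dvd_diff_nat) (use b in auto)
    ultimately have "m dvd a - (i + d * p)"
      by simp
    then have "m \<le> a - (i + d * p)"
      using \<open>i + d * p < a\<close> by (intro dvd_imp_le) auto
    moreover have "d \<le> d * p"
      using assms by simp
    ultimately have "b \<le> a"
      using d by linarith
    then show ?thesis
      by (rule div_le_mono)
  qed simp
qed

text \<open>Here \<open>(a, p * m)\<close> is divided by \<open>(i, p)\<close>. The congruence
  modulo \<open>p\<close> forces \<open>a mod p = i\<close>, so \<open>a div p\<close> is itself
  admissible for \<open>c\<close> and bounds \<open>b\<close>.\<close>

lemma resid_dvd_bound:
  fixes a b i m n p :: nat
  assumes "1 \<le> p" "1 \<le> m" "1 \<le> n" "i < p"
    and H: "\<And>c k. 1 \<le> k \<Longrightarrow>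
      (a \<le> i + c * p \<and> p * m dvd i + c * p - a \<and> p * m dvd p * k) \<longleftrightarrow>
      (b \<le> c \<and> n dvd c - b \<and> n dvd k)"
  shows "n = m" "b div m \<le> a div (p * m)"
proof -
  have b: "a \<le> i + b * p" "p * m dvd i + b * p - a" "p * m dvd p * n"
    using H[where k=n and c=b] assms(1-4) by auto
  then have "p dvd i + b * p - a"
    using dvd_mult_left by blast
  then have "(i + b * p) mod p = a mod p"
    using b(1) mod_eq_dvd_iff_nat[of a "i + b * p" p] by blast
  then have "a mod p = i"
    using assms by simp
  then have "i + a div p * p = a"
    using mod_div_mult_eq[of a p] by simp
  then have "b \<le> a div p" "n dvd m"
    using H[where k=m and c="a div p"] assms(1-4) by auto
  moreover have "m dvd n"
    using b(3) assms by simp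
  ultimately show "n = m" "b div m \<le> a div (p * m)"
    by (auto simp: div_mult2_eq dvd_antisym intro: div_le_mono)
qed

text \<open>The second component of a generator is 1 or a prime, hence coprime to \<open>m\<close>
  or a divisor of it. The modulus stays in the first case and loses one prime factor in the second;
  \<open>a div m\<close> does not grow in either.\<close>

lemma nat_affine_len_resid:
  assumes "(i, p) \<in> nat_affine_P0" "1 \<le> m" "1 \<le> n"
    and "\<forall>u\<in>carrier nat_affine. (a, m) divides\<^bsub>nat_affine\<^esub> (i, p) \<otimes>\<^bsub>nat_affine\<^esub> u \<longleftrightarrow>
      (b, n) divides\<^bsub>nat_affine\<^esub> u"
  shows "nat_affine_len (b, n) \<le> nat_affine_len (a, m)"
proof -
  have p: "1 \<le> p"
    using assms(1) prime_ge_1_nat by (auto simp: nat_affine_P0_def)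
  have H: "(a \<le> i + c * p \<and> m dvd i + c * p - a \<and> m dvd p * k) \<longleftrightarrow>
      (b \<le> c \<and> n dvd c - b \<and> n dvd k)" if "1 \<le> k" for c k
    using bspec[OF assms(4), of "(c, k)"] that p
    by (simp add: nat_affine_divides_iff Suc_le_eq)
  show ?thesis
  proof (cases "coprime m p")
    case True
    then show ?thesis
      using resid_coprime_bound[of p m n a i b] H p assms by (simp add: nat_affine_len_def)
  next
    case False
    then have "p \<noteq> 1" by auto
    then have pr: "Factorial_Ring.prime p" "i < p"
      using assms(1) by (auto simp: nat_affine_P0_def)
    then have "p dvd m"
      using False prime_imp_coprime coprime_commute by blast
    then obtain l where l: "m = p * l"
      by blast
    have "0 < l"
      using l assms by (auto intro: gr0I)
    then have "n = l" "b div l \<le> a div m"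
      using resid_dvd_bound[of p l n i a b] H p assms(3) pr l by auto
    then show ?thesis
      using \<open>0 < l\<close> p by (simp add: nat_affine_len_def l prime_factorization_mult)
  qed
qed

interpretation nat_affine: generated_lcm_monoid nat_affine nat_affine_P0 nat_affine_len
proof (intro generated_lcm_monoid.intro right_lcm_monoid.intro right_lcm_monoid_axioms.intro
    generated_lcm_monoid_axioms.intro)
  show "monoid nat_affine"
    by (rule monoid_nat_affine)
next
  fix p s t
  assume "p \<otimes>\<^bsub>nat_affine\<^esub> s = p \<otimes>\<^bsub>nat_affine\<^esub> t" "p \<in> carrier nat_affine"
  then show "s = t"
    by (cases p; cases s; cases t) auto
next
  fix p q
  assume "p \<otimes>\<^bsub>nat_affine\<^esub> q = \<one>\<^bsub>nat_affine\<^esub>"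
  then show "p = \<one>\<^bsub>nat_affine\<^esub>"
    by (cases p; cases q) auto
next
  fix p q t
  assume "p \<in> carrier nat_affine" "q \<in> carrier nat_affine" "t \<in> carrier nat_affine"
    "p divides\<^bsub>nat_affine\<^esub> t" "q divides\<^bsub>nat_affine\<^esub> t"
  then show "\<exists>r\<in>carrier nat_affine. \<forall>u\<in>carrier nat_affine.
      (p divides\<^bsub>nat_affine\<^esub> u \<and> q divides\<^bsub>nat_affine\<^esub> u) \<longleftrightarrow> r divides\<^bsub>nat_affine\<^esub> u"
    using nat_affine_right_lcm[of "snd p" "snd q" "fst p" "fst t" "fst q"]
    by (cases p; cases q; cases t) (simp add: nat_affine_divides_iff)
next
  show "nat_affine_P0 \<subseteq> carrier nat_affine"
    by (auto simp: nat_affine_P0_def prime_ge_1_nat Suc_le_eq prime_gt_0_nat)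
next
  show "nat_affine_len \<one>\<^bsub>nat_affine\<^esub> = 0"
    by (simp add: nat_affine_len_def)
next
  fix q assume "q \<in> nat_affine_P0"
  then show "0 < nat_affine_len q"
    by (auto simp: nat_affine_P0_def nat_affine_len_def prime_factorization_prime)
next
  fix x
  assume "x \<in> carrier nat_affine" "x \<noteq> \<one>\<^bsub>nat_affine\<^esub>" "x \<notin> nat_affine_P0"
  then show "\<exists>q\<in>nat_affine_P0. \<exists>r\<in>carrier nat_affine. x = q \<otimes>\<^bsub>nat_affine\<^esub> r \<and>
      nat_affine_len q < nat_affine_len x \<and> nat_affine_len r < nat_affine_len x"
    using nat_affine_factor[of "snd x" "fst x"] by (cases x) simp
next
  fix q x t
  assume "q \<in> nat_affine_P0" "x \<in> carrier nat_affine" "t \<in> carrier nat_affine"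
    "\<forall>u\<in>carrier nat_affine. x divides\<^bsub>nat_affine\<^esub> q \<otimes>\<^bsub>nat_affine\<^esub> u \<longleftrightarrow>
      t divides\<^bsub>nat_affine\<^esub> u"
  then show "nat_affine_len t \<le> nat_affine_len x"
    using nat_affine_len_resid[of "fst q" "snd q" "snd x" "snd t" "fst x" "fst t"]
    by (cases q; cases x; cases t) simp
qed

theorem theorem5p9:
  fixes T :: "nat \<times> nat \<Rightarrow> 'a::chilbert_space \<Rightarrow> 'a"
  assumes "unital_contractive_rep nat_affine T"
  shows "has_star_regular_dilation nat_affine T \<longleftrightarrow>
    (\<forall>F. finite F \<and> F \<subseteq> nat_affine_P0 \<longrightarrow>
      positive_op (\<lambda>h. \<Sum>U\<in>Pow F. (-1) ^ card U *\<^sub>R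
        rep_ext T (rjoin nat_affine U) (cadjoint (rep_ext T (rjoin nat_affine U)) h)))"
  using assms by (rule nat_affine.has_star_regular_dilation_iff)

end
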